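(* Let $k\ge8$ be even and let $\Gamma=\langle\gamma\rangle$ be a cyclic group of order $k$. Consider the following two $\Gamma$-gain graphs. (A) $(G_A,\psi_A)$ has a single vertex $v$, which is free, and exactly two edges: loops $f_1,f_2$ at $v$ with gains $\gamma$ and $\gamma^3$. (B) $(G_B,\psi_B)$ has two free vertices $u,v$ and one fixed vertex $v_0$, and exactly the edges: loops $f_1,f_2$ at $u$ with gains $\gamma$ and $\gamma^3$, a loop $f_3$ at $v$ with gain $\gamma^2$, and edges $e_1=(u,v)$, $e_2=(v,v_0)$ with gain $\mathrm{id}$. Each of these gain graphs has a $(2,0,3,1)$-gain tight spanning subgraph, a $(2,1,3,1)$-gain tight spanning subgraph, and, for every $2\le j\le k-2$, a $\mathbb{Z}_k^j$-gain tight spanning subgraph. However, no $\mathcal{C}_k$-symmetric realisation in $\mathbb{R}^2$ of the $\Gamma$-lifting of $(G_A,\psi_A)$ or of $(G_B,\psi_B)$ is infinitesimally rigid. Moreover, every $\mathcal{C}_k$-symmetric realisation of the $\Gamma$-lifting of $(G_A,\psi_A)$, and every $\mathcal{C}_k$-generic realisation of the $\Gamma$-lifting of $(G_B,\psi_B)$, has a non-trivial $\rho_{k/2}$-symmetric infinitesimal motion.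
   Context: Frameworks. A framework (realisation of $\tilde G$) in $\mathbb{R}^2$ is a pair $(\tilde G,\tilde p)$ with $\tilde G$ a finite simple graph and $\tilde p:V(\tilde G)\to\mathbb{R}^2$ injective with $\tilde p(V(\tilde G))$ affinely spanning $\mathbb{R}^2$. An infinitesimal motion is $m:V(\tilde G)\to\mathbb{R}^2$ with $(\tilde p(u)-\tilde p(v))^T(m(u)-m(v))=0$ for all edges $\{u,v\}$; it is trivial if $m(u)=M\tilde p(u)+t$ for all $u$, for some skew-symmetric $2\times2$ matrix $M$ and vector $t$. The framework is infinitesimally rigid if all infinitesimal motions are trivial. The rigidity matrix $R(\tilde G,\tilde p)$ is the matrix of this linear system. Symmetry. $\tau_k:\Gamma\to\mathcal{C}_k$ is the isomorphism sending $\gamma$ to the anticlockwise rotation $C_k$ about the origin by $2\pi/k$. $\tilde G$ is $\Gamma$-symmetric if it comes with an action of $\Gamma$ by graph automorphisms; $(\tilde G,\tilde p)$ is $\mathcal{C}_k$-symmetric if $\tau_k(\delta)\tilde p(v)=\tilde p(\delta v)$ for all $\delta,v$, and $\mathcal{C}_k$-generic if moreover $\operatorname{rank}R(\tilde G,\tilde p)\ge\operatorname{rank}R(\tilde G,\tilde q)$ for all $\mathcal{C}_k$-symmetric $(\tilde G,\tilde q)$ with the same action. With $\rho_j(\gamma)=\exp(2\pi ij/k)$, a motion $m$ is $\rho_j$-symmetric if $m(\delta v)=\overline{\rho_j(\delta)}\tau_k(\delta)m(v)$ for all $v,\delta$; for $j=k/2$ this reads $m(\gamma^t v)=(-1)^tC_k^tm(v)$.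 Gain graphs. A $\Gamma$-gain graph $(G,\psi)$ is a finite directed multigraph $G$ with a partition $V(G)=V_0(G)\,\dot\cup\,\overline{V(G)}$, $|V_0(G)|\le1$ (fixed vertex / free vertices), and $\psi:E(G)\to\Gamma$ such that: parallel edges $e,f$ have $\psi(e)\ne\psi(f)$ if equally directed and $\psi(e)\neq\psi(f)^{-1}$ if oppositely directed (for two loops at the same vertex both are required); the fixed vertex has no loop and no parallel edges; loops have gain $\ne\mathrm{id}$. Its $\Gamma$-lifting is the $\Gamma$-symmetric graph with vertices $(v,g)$ for $v$ free, $g\in\Gamma$, together with the fixed vertex $v_0$ if present; $\Gamma$ acts by $\delta(v,g)=(v,\delta g)$ and $\delta v_0=v_0$; an edge $(u,v)$ of gain $\delta$ between free vertices (possibly $u=v$) gives the edges $\{(u,g),(v,g\delta)\}$, $g\in\Gamma$, and an edge between a free vertex $v$ and $v_0$ gives the edges $\{(v,g),v_0\}$, $g\in\Gamma$. The gain of a walk is the product of the gains of its edges, with exponent $-1$ for edges traversed against their direction. For a subgraph $H$, $V_0(H)=V_0(G)\cap V(H)$, $\overline{V(H)}=\overline{V(G)}\cap V(H)$, and $\langle H\rangle$ is the subgroup of $\Gamma$ generated by the gains of closed walks in $H$ not using the fixed vertex. $H$ is balanced if $\langle H\rangle=\{\mathrm{id}\}$, else unbalanced. If $V_0(H)=\emptyset$, $H$ is near-balanced if it is unbalanced and there are $v\in V(H)$, $\delta\in\Gamma$ such that all closed walks in $H$ starting at $v$ and not containing $v$ as an internal vertex have gain in $\{\mathrm{id},\delta,\delta^{-1}\}$;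 it is proper near-balanced if moreover $\langle H\rangle\not\simeq\mathbb{Z}_2,\mathbb{Z}_3$. Sparsity. $(G,\psi)$ is $(2,m,l)$-sparse if $|E(H)|\le 2|\overline{V(H)}|+m|V_0(H)|-l$ for all subgraphs $H$ with $E(H)\ne\emptyset$, and $(2,m,l)$-tight if moreover equality holds for $H=G$. $(2,l)$-sparse means $(2,2,l)$-sparse. $(G,\psi)$ is $(2,m,3,l)$-gain-sparse if it is $(2,m,l)$-sparse and all its balanced subgraphs with non-empty edge set are $(2,3)$-sparse; it is $(2,m,3,l)$-gain tight if it is $(2,m,3,l)$-gain-sparse and $(2,m,l)$-tight. For $i\in\{-1,0,1\}$ let $S_i(k,j)$ be the set of integers $n\ge2$ with $n\mid k$, $j\equiv i \pmod n$, and additionally $n\neq2$ if $j$ is odd. A graph $X$ is $S_0(k,j)$ if $\langle X\rangle\simeq\mathbb{Z}_n$ with $n\in S_0(k,j)$, and $S_{\pm1}(k,j)$ if $\langle X\rangle\simeq\mathbb{Z}_n$ with $n\in S_{-1}(k,j)\cup S_1(k,j)$. For $2\le j\le k-2$ and connected $X$ define $\alpha_k^j(X)$ to be: $0$ if $X$ is balanced; $1$ if $j$ is odd and $\langle X\rangle\simeq\mathbb{Z}_2$; $2-|V_0(X)|$ if $X$ is $S_{\pm1}(k,j)$; $2-2|V_0(X)|$ if $X$ is $S_0(k,j)$, or $V_0(X)=\emptyset$ and $X$ is proper near-balanced; $3-2|V_0(X)|$ otherwise. For $F\subseteq E(G)$ let $f_k^j(F)=\sum_X(2|V(X)|-3+\alpha_k^j(X))$,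 the sum being over the connected components $X$ of the subgraph formed by the edges in $F$ and their endpoints. $(G,\psi)$ is $\mathbb{Z}_k^j$-gain sparse if $|E(H)|\le f_k^j(E(H))$ for all subgraphs $H$ with $E(H)\neq\emptyset$; it is $\mathbb{Z}_k^j$-gain tight if it is $\mathbb{Z}_k^j$-gain sparse and $|E(G)|=2|\overline{V(G)}|$. A spanning subgraph is one with vertex set $V(G)$. *)

theory Defs
  imports
    "HOL-Analysis.Analysis"
    "HOL-Algebra.Algebra"
    "HOL-Library.Function_Algebras"
    "Graph_Theory.Digraph_Component"
begin

section \<open>Frameworks in the plane\<close>

record 'a sgraph =
  sverts :: "'a set"
  sedges :: "'a set set"

definition simple_graph :: "'a sgraph \<Rightarrow> bool" where
  "simple_graph G \<longleftrightarrow> finite (sverts G) \<and>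
     (\<forall>e\<in>sedges G. \<exists>u\<in>sverts G. \<exists>v\<in>sverts G. u \<noteq> v \<and> e = {u, v})"

definition framework :: "'a sgraph \<Rightarrow> ('a \<Rightarrow> real^2) \<Rightarrow> bool" where
  "framework G p \<longleftrightarrow> simple_graph G \<and> inj_on p (sverts G) \<and> affine hull (p ` sverts G) = UNIV"

definition inf_motion :: "'a sgraph \<Rightarrow> ('a \<Rightarrow> real^2) \<Rightarrow> ('a \<Rightarrow> real^2) \<Rightarrow> bool" where
  "inf_motion G p m \<longleftrightarrow> (\<forall>u v. {u, v} \<in> sedges G \<longrightarrow> (p u - p v) \<bullet> (m u - m v) = 0)"

definition trivial_motion :: "'a sgraph \<Rightarrow> ('a \<Rightarrow> real^2) \<Rightarrow> ('a \<Rightarrow> real^2) \<Rightarrow> bool" where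
  "trivial_motion G p m \<longleftrightarrow>
     (\<exists>(M :: real^2^2) t. transpose M = - M \<and> (\<forall>u\<in>sverts G. m u = M *v p u + t))"

definition inf_rigid :: "'a sgraph \<Rightarrow> ('a \<Rightarrow> real^2) \<Rightarrow> bool" where
  "inf_rigid G p \<longleftrightarrow> (\<forall>m. inf_motion G p m \<longrightarrow> trivial_motion G p m)"

text \<open>Row of the rigidity matrix at an edge \<open>e = {u, v}\<close>: it is \<open>p u - p v\<close> in the two columns
  of \<open>u\<close>, \<open>p v - p u\<close> in those of \<open>v\<close>, and zero elsewhere. A row is a vector indexed by
  vertices with entries in the plane; the rank is the dimension of the row space.\<close>

definition rigidity_row :: "('a \<Rightarrow> real^2) \<Rightarrow> 'a set \<Rightarrow> 'a \<Rightarrow> real^2" where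
  "rigidity_row p e = (\<lambda>u. if u \<in> e then \<Sum>w\<in>e. p u - p w else 0)"

definition row_scale :: "real \<Rightarrow> ('a \<Rightarrow> real^2) \<Rightarrow> 'a \<Rightarrow> real^2" where
  "row_scale c r = (\<lambda>u. c *\<^sub>R r u)"

lemma vector_space_row_scale: "vector_space row_scale"
  by unfold_locales (auto simp: row_scale_def fun_eq_iff algebra_simps)

definition rigidity_rank :: "'a sgraph \<Rightarrow> ('a \<Rightarrow> real^2) \<Rightarrow> nat" where
  "rigidity_rank G p = vector_space.dim row_scale (rigidity_row p ` sedges G)"


section \<open>Symmetry\<close>

definition rotation :: "real \<Rightarrow> real^2^2" where
  "rotation \<theta> = vector [vector [cos \<theta>, - sin \<theta>], vector [sin \<theta>, cos \<theta>]]"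

definition exponent :: "('g, 'b) monoid_scheme \<Rightarrow> 'g \<Rightarrow> 'g \<Rightarrow> nat" where
  "exponent \<Gamma> \<gamma> \<delta> = (LEAST t. \<gamma> [^]\<^bsub>\<Gamma>\<^esub> t = \<delta>)"

definition tau :: "('g, 'b) monoid_scheme \<Rightarrow> 'g \<Rightarrow> 'g \<Rightarrow> real^2^2" where
  "tau \<Gamma> \<gamma> \<delta> = rotation (2 * pi * real (exponent \<Gamma> \<gamma> \<delta>) / real (order \<Gamma>))"

definition rho :: "('g, 'b) monoid_scheme \<Rightarrow> 'g \<Rightarrow> nat \<Rightarrow> 'g \<Rightarrow> complex" where
  "rho \<Gamma> \<gamma> j \<delta> = exp (2 * of_real pi * \<i> * of_nat j * of_nat (exponent \<Gamma> \<gamma> \<delta>) / of_nat (order \<Gamma>))"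

lemma tau_rho_pow:
  assumes "group \<Gamma>" "\<gamma> \<in> carrier \<Gamma>" "carrier \<Gamma> = generate \<Gamma> {\<gamma>}" "finite (carrier \<Gamma>)"
  shows "tau \<Gamma> \<gamma> (\<gamma> [^]\<^bsub>\<Gamma>\<^esub> (t::nat)) = rotation (2 * pi * real t / real (order \<Gamma>))"
    and "rho \<Gamma> \<gamma> j (\<gamma> [^]\<^bsub>\<Gamma>\<^esub> t) = exp (2 * of_real pi * \<i> * of_nat j * of_nat t / of_nat (order \<Gamma>))"
proof -
  interpret group \<Gamma> by fact
  define s where "s = exponent \<Gamma> \<gamma> (\<gamma> [^]\<^bsub>\<Gamma>\<^esub> t)"
  have s: "\<gamma> [^]\<^bsub>\<Gamma>\<^esub> s = \<gamma> [^]\<^bsub>\<Gamma>\<^esub> t" unfolding s_def exponent_def by (rule LeastI) simp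
  have "s \<le> t" unfolding s_def exponent_def by (rule Least_le) simp
  have k: "ord \<gamma> = order \<Gamma>" "order \<Gamma> > 0"
    using assms generate_pow_card[of \<gamma>] by (auto simp: order_def card_gt_0_iff)
  have "\<gamma> [^]\<^bsub>\<Gamma>\<^esub> (t - s) = \<one>\<^bsub>\<Gamma>\<^esub>"
    using s \<open>s \<le> t\<close> assms(2) by (metis le_add_diff_inverse l_cancel_one' nat_pow_closed nat_pow_mult)
  then obtain q where q: "t - s = order \<Gamma> * q"
    using pow_eq_id[OF assms(2)] k by (auto elim: dvdE)
  then have t: "t = s + order \<Gamma> * q" using \<open>s \<le> t\<close> by simp
  have 1: "2 * pi * real t / real (order \<Gamma>) = 2 * pi * real s / real (order \<Gamma>) + 2 * pi * of_int (int q)"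
    using k(2) unfolding t by (simp add: field_simps)
  show "tau \<Gamma> \<gamma> (\<gamma> [^]\<^bsub>\<Gamma>\<^esub> t) = rotation (2 * pi * real t / real (order \<Gamma>))"
    unfolding tau_def s_def[symmetric] 1 rotation_def
    using cos_int_2pin[of "int q"] sin_int_2pin[of "int q"] by (simp add: cos_add sin_add)
  have 2: "2 * of_real pi * \<i> * of_nat j * of_nat t / of_nat (order \<Gamma>) =
    2 * of_real pi * \<i> * of_nat j * of_nat s / of_nat (order \<Gamma>) + 2 * of_nat (j * q) * of_real pi * \<i>"
    using k(2) unfolding t by (simp add: field_simps)
  have 3: "exp (2 * of_nat (j * q) * of_real pi * \<i>) = 1"
    by (subst exp_eq_1) (auto intro!: exI[of _ "int (j*q)"])
  show "rho \<Gamma> \<gamma> j (\<gamma> [^]\<^bsub>\<Gamma>\<^esub> t) = exp (2 * of_real pi * \<i> * of_nat j * of_nat t / of_nat (order \<Gamma>))"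
    unfolding rho_def s_def[symmetric] 2 exp_add 3 by simp
qed

definition symmetric_graph ::
  "('g, 'b) monoid_scheme \<Rightarrow> ('g \<Rightarrow> 'a \<Rightarrow> 'a) \<Rightarrow> 'a sgraph \<Rightarrow> bool" where
  "symmetric_graph \<Gamma> act G \<longleftrightarrow> simple_graph G \<and>
     group_action \<Gamma> (sverts G) (\<lambda>\<delta>. restrict (act \<delta>) (sverts G)) \<and>
     (\<forall>\<delta>\<in>carrier \<Gamma>. \<forall>u\<in>sverts G. \<forall>v\<in>sverts G.
        {act \<delta> u, act \<delta> v} \<in> sedges G \<longleftrightarrow> {u, v} \<in> sedges G)"

definition Ck_symmetric ::
  "('g, 'b) monoid_scheme \<Rightarrow> 'g \<Rightarrow> ('g \<Rightarrow> 'a \<Rightarrow> 'a) \<Rightarrow> 'a sgraph \<Rightarrow> ('a \<Rightarrow> real^2) \<Rightarrow> bool" where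
  "Ck_symmetric \<Gamma> \<gamma> act G p \<longleftrightarrow> symmetric_graph \<Gamma> act G \<and> framework G p \<and>
     (\<forall>\<delta>\<in>carrier \<Gamma>. \<forall>v\<in>sverts G. tau \<Gamma> \<gamma> \<delta> *v p v = p (act \<delta> v))"

definition Ck_generic ::
  "('g, 'b) monoid_scheme \<Rightarrow> 'g \<Rightarrow> ('g \<Rightarrow> 'a \<Rightarrow> 'a) \<Rightarrow> 'a sgraph \<Rightarrow> ('a \<Rightarrow> real^2) \<Rightarrow> bool" where
  "Ck_generic \<Gamma> \<gamma> act G p \<longleftrightarrow> Ck_symmetric \<Gamma> \<gamma> act G p \<and>
     (\<forall>q. Ck_symmetric \<Gamma> \<gamma> act G q \<longrightarrow> rigidity_rank G q \<le> rigidity_rank G p)"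

text \<open>The defining equation is over the complex numbers, so it is stated componentwise for the
  complexification of the (real) motion \<open>m\<close>.\<close>

definition rho_symmetric ::
  "('g, 'b) monoid_scheme \<Rightarrow> 'g \<Rightarrow> ('g \<Rightarrow> 'a \<Rightarrow> 'a) \<Rightarrow> 'a sgraph \<Rightarrow> nat \<Rightarrow> ('a \<Rightarrow> real^2) \<Rightarrow> bool" where
  "rho_symmetric \<Gamma> \<gamma> act G j m \<longleftrightarrow>
     (\<forall>\<delta>\<in>carrier \<Gamma>. \<forall>v\<in>sverts G. \<forall>i.
        complex_of_real (m (act \<delta> v) $ i)
          = cnj (rho \<Gamma> \<gamma> j \<delta>) * complex_of_real ((tau \<Gamma> \<gamma> \<delta> *v m v) $ i))"


section \<open>Gain graphs and their liftings\<close>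

text \<open>A gain graph is given by a directed multigraph \<open>G\<close>, the set \<open>V0\<close> of its fixed vertices and
  the gain function \<open>\<psi>\<close>. Subgraphs \<open>H\<close> keep \<open>V0\<close> and \<open>\<psi>\<close>; their fixed and free vertices are
  \<open>V0 \<inter> verts H\<close> and \<open>verts H - V0\<close>.\<close>

definition gain_graph ::
  "('g, 'b) monoid_scheme \<Rightarrow> 'v set \<Rightarrow> ('e \<Rightarrow> 'g) \<Rightarrow> ('v, 'e) pre_digraph \<Rightarrow> bool" where
  "gain_graph \<Gamma> V0 \<psi> G \<longleftrightarrow>
     fin_digraph G \<and> V0 \<subseteq> verts G \<and> card V0 \<le> 1 \<and> \<psi> \<in> arcs G \<rightarrow> carrier \<Gamma> \<and>
     (\<forall>e\<in>arcs G. \<forall>f\<in>arcs G. e \<noteq> f \<longrightarrow>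
        (tail G e = tail G f \<and> head G e = head G f \<longrightarrow> \<psi> e \<noteq> \<psi> f) \<and>
        (tail G e = head G f \<and> head G e = tail G f \<longrightarrow> \<psi> e \<noteq> inv\<^bsub>\<Gamma>\<^esub> (\<psi> f)) \<and>
        ({tail G e, head G e} \<inter> V0 \<noteq> {} \<longrightarrow> {tail G e, head G e} \<noteq> {tail G f, head G f})) \<and>
     (\<forall>e\<in>arcs G. tail G e = head G e \<longrightarrow> tail G e \<notin> V0 \<and> \<psi> e \<noteq> \<one>\<^bsub>\<Gamma>\<^esub>)"

datatype ('v, 'g) lvertex = Free 'v 'g | Fixed 'v

definition lvert :: "'v set \<Rightarrow> 'v \<Rightarrow> 'g \<Rightarrow> ('v, 'g) lvertex" where
  "lvert V0 v g = (if v \<in> V0 then Fixed v else Free v g)"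

definition lifting ::
  "('g, 'b) monoid_scheme \<Rightarrow> 'v set \<Rightarrow> ('e \<Rightarrow> 'g) \<Rightarrow> ('v, 'e) pre_digraph \<Rightarrow> ('v, 'g) lvertex sgraph" where
  "lifting \<Gamma> V0 \<psi> G =
     \<lparr>sverts = {lvert V0 v g | v g. v \<in> verts G \<and> g \<in> carrier \<Gamma>},
      sedges = {{lvert V0 (tail G e) g, lvert V0 (head G e) (g \<otimes>\<^bsub>\<Gamma>\<^esub> \<psi> e)} | e g.
                  e \<in> arcs G \<and> g \<in> carrier \<Gamma>}\<rparr>"

fun lift_act :: "('g, 'b) monoid_scheme \<Rightarrow> 'g \<Rightarrow> ('v, 'g) lvertex \<Rightarrow> ('v, 'g) lvertex" where
  "lift_act \<Gamma> \<delta> (Free v g) = Free v (\<delta> \<otimes>\<^bsub>\<Gamma>\<^esub> g)"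
| "lift_act \<Gamma> \<delta> (Fixed v) = Fixed v"

lemma symmetric_graph_lifting:
  assumes "group \<Gamma>" "finite (carrier \<Gamma>)" "gain_graph \<Gamma> V0 \<psi> G"
  shows "symmetric_graph \<Gamma> (lift_act \<Gamma>) (lifting \<Gamma> V0 \<psi> G)"
proof -
  interpret group \<Gamma> by fact
  interpret fin_digraph G using assms(3) by (simp add: gain_graph_def)
  let ?L = "lifting \<Gamma> V0 \<psi> G"
  have \<psi>: "\<psi> e \<in> carrier \<Gamma>" if "e \<in> arcs G" for e
    using assms(3) that by (auto simp: gain_graph_def)
  have loop: "tail G e \<notin> V0 \<and> \<psi> e \<noteq> \<one>\<^bsub>\<Gamma>\<^esub>" if "e \<in> arcs G" "tail G e = head G e" for e
    using assms(3) that by (auto simp: gain_graph_def)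
  have act: "lift_act \<Gamma> \<delta> (lvert V0 v g) = lvert V0 v (\<delta> \<otimes>\<^bsub>\<Gamma>\<^esub> g)" for \<delta> v g
    by (simp add: lvert_def)
  have V: "sverts ?L = (\<lambda>(v, g). lvert V0 v g) ` (verts G \<times> carrier \<Gamma>)"
    by (auto simp: lifting_def)
  have V2: "lvert V0 v g \<in> sverts ?L" if "v \<in> verts G" "g \<in> carrier \<Gamma>" for v g
    using that unfolding lifting_def by auto
  have closed: "lift_act \<Gamma> \<delta> x \<in> sverts ?L" if "\<delta> \<in> carrier \<Gamma>" "x \<in> sverts ?L" for \<delta> x
    using that unfolding lifting_def by (fastforce simp: act)
  have comp: "lift_act \<Gamma> \<delta> (lift_act \<Gamma> \<epsilon> x) = lift_act \<Gamma> (\<delta> \<otimes>\<^bsub>\<Gamma>\<^esub> \<epsilon>) x"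
    if "\<delta> \<in> carrier \<Gamma>" "\<epsilon> \<in> carrier \<Gamma>" "x \<in> sverts ?L" for \<delta> \<epsilon> x
    using that unfolding lifting_def by (auto simp: act m_assoc)
  have id: "lift_act \<Gamma> \<one>\<^bsub>\<Gamma>\<^esub> x = x" if "x \<in> sverts ?L" for x
    using that unfolding lifting_def by (auto simp: act)
  have inv: "lift_act \<Gamma> (inv\<^bsub>\<Gamma>\<^esub> \<delta>) (lift_act \<Gamma> \<delta> x) = x"
            "lift_act \<Gamma> \<delta> (lift_act \<Gamma> (inv\<^bsub>\<Gamma>\<^esub> \<delta>) x) = x"
    if "\<delta> \<in> carrier \<Gamma>" "x \<in> sverts ?L" for \<delta> x
    using that by (simp_all add: comp id)
  have simple: "simple_graph ?L"
    unfolding simple_graph_def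
  proof (intro conjI ballI)
    show "finite (sverts ?L)" unfolding V using assms(2) by simp
  next
    fix e assume "e \<in> sedges ?L"
    then obtain a g where a: "a \<in> arcs G" "g \<in> carrier \<Gamma>"
      and e: "e = {lvert V0 (tail G a) g, lvert V0 (head G a) (g \<otimes>\<^bsub>\<Gamma>\<^esub> \<psi> a)}"
      by (auto simp: lifting_def)
    have "lvert V0 (tail G a) g \<noteq> lvert V0 (head G a) (g \<otimes>\<^bsub>\<Gamma>\<^esub> \<psi> a)"
    proof
      assume eq: "lvert V0 (tail G a) g = lvert V0 (head G a) (g \<otimes>\<^bsub>\<Gamma>\<^esub> \<psi> a)"
      then have "tail G a = head G a" by (auto simp: lvert_def split: if_splits)
      with loop[OF a(1)] eq have "g = g \<otimes>\<^bsub>\<Gamma>\<^esub> \<psi> a" "\<psi> a \<noteq> \<one>\<^bsub>\<Gamma>\<^esub>" by (auto simp: lvert_def)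
      then show False using a \<psi>[OF a(1)] by (metis l_cancel_one')
    qed
    moreover have "lvert V0 (tail G a) g \<in> sverts ?L" "lvert V0 (head G a) (g \<otimes>\<^bsub>\<Gamma>\<^esub> \<psi> a) \<in> sverts ?L"
      using a \<psi>[OF a(1)] by (auto simp: V2)
    ultimately show "\<exists>u\<in>sverts ?L. \<exists>v\<in>sverts ?L. u \<noteq> v \<and> e = {u, v}" using e by blast
  qed
  have bij: "restrict (lift_act \<Gamma> \<delta>) (sverts ?L) \<in> Bij (sverts ?L)" if "\<delta> \<in> carrier \<Gamma>" for \<delta>
    unfolding Bij_def using that
    by (auto intro!: bij_betw_byWitness[where f' = "lift_act \<Gamma> (inv\<^bsub>\<Gamma>\<^esub> \<delta>)"] simp: closed inv)
  have "group_action \<Gamma> (sverts ?L) (\<lambda>\<delta>. restrict (lift_act \<Gamma> \<delta>) (sverts ?L))"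
    unfolding group_action_def group_hom_def group_hom_axioms_def
  proof (intro conjI)
    show "group (BijGroup (sverts ?L))" by (rule group_BijGroup)
    show "group \<Gamma>" by fact
    show "(\<lambda>\<delta>. restrict (lift_act \<Gamma> \<delta>) (sverts ?L)) \<in> hom \<Gamma> (BijGroup (sverts ?L))"
      unfolding hom_def
      by (auto simp: BijGroup_def bij)
        (auto simp: compose_def restrict_def fun_eq_iff closed comp)
  qed
  moreover have edge: "{lift_act \<Gamma> \<delta> u, lift_act \<Gamma> \<delta> v} \<in> sedges ?L"
    if \<delta>: "\<delta> \<in> carrier \<Gamma>" and uv: "{u, v} \<in> sedges ?L" for \<delta> u v
  proof -
    obtain a g where a: "a \<in> arcs G" "g \<in> carrier \<Gamma>"
      and e: "{u, v} = {lvert V0 (tail G a) g, lvert V0 (head G a) (g \<otimes>\<^bsub>\<Gamma>\<^esub> \<psi> a)}"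
      using uv by (auto simp: lifting_def)
    have "{lift_act \<Gamma> \<delta> u, lift_act \<Gamma> \<delta> v} = lift_act \<Gamma> \<delta> ` {u, v}" by simp
    also have "\<dots> = {lvert V0 (tail G a) (\<delta> \<otimes>\<^bsub>\<Gamma>\<^esub> g), lvert V0 (head G a) (\<delta> \<otimes>\<^bsub>\<Gamma>\<^esub> g \<otimes>\<^bsub>\<Gamma>\<^esub> \<psi> a)}"
      unfolding e using \<delta> a \<psi>[OF a(1)] by (simp add: act m_assoc)
    finally show ?thesis using a \<delta> by (auto simp: lifting_def)
  qed
  moreover have "{u, v} \<in> sedges ?L"
    if "\<delta> \<in> carrier \<Gamma>" "u \<in> sverts ?L" "v \<in> sverts ?L"
       "{lift_act \<Gamma> \<delta> u, lift_act \<Gamma> \<delta> v} \<in> sedges ?L" for \<delta> u v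
    using edge[of "inv\<^bsub>\<Gamma>\<^esub> \<delta>" "lift_act \<Gamma> \<delta> u" "lift_act \<Gamma> \<delta> v"] that by (simp add: inv)
  ultimately show ?thesis using simple unfolding symmetric_graph_def by blast
qed


section \<open>Walks, gains and balance\<close>

text \<open>A step of a walk is an arc together with a flag telling whether the arc is traversed along
  its direction; \<open>gwalk H u w v\<close> says that \<open>w\<close> is a walk of \<open>H\<close> from \<open>u\<close> to \<open>v\<close>.\<close>

definition step_from :: "('v, 'e) pre_digraph \<Rightarrow> 'e \<times> bool \<Rightarrow> 'v" where
  "step_from H s = (if snd s then tail H (fst s) else head H (fst s))"

definition step_to :: "('v, 'e) pre_digraph \<Rightarrow> 'e \<times> bool \<Rightarrow> 'v" where
  "step_to H s = (if snd s then head H (fst s) else tail H (fst s))"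

fun gwalk :: "('v, 'e) pre_digraph \<Rightarrow> 'v \<Rightarrow> ('e \<times> bool) list \<Rightarrow> 'v \<Rightarrow> bool" where
  "gwalk H u [] v \<longleftrightarrow> u \<in> verts H \<and> u = v"
| "gwalk H u (s # w) v \<longleftrightarrow> fst s \<in> arcs H \<and> step_from H s = u \<and> gwalk H (step_to H s) w v"

fun walk_gain :: "('g, 'b) monoid_scheme \<Rightarrow> ('e \<Rightarrow> 'g) \<Rightarrow> ('e \<times> bool) list \<Rightarrow> 'g" where
  "walk_gain \<Gamma> \<psi> [] = \<one>\<^bsub>\<Gamma>\<^esub>"
| "walk_gain \<Gamma> \<psi> (s # w) =
     (if snd s then \<psi> (fst s) else inv\<^bsub>\<Gamma>\<^esub> (\<psi> (fst s))) \<otimes>\<^bsub>\<Gamma>\<^esub> walk_gain \<Gamma> \<psi> w"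

definition gain_group ::
  "('g, 'b) monoid_scheme \<Rightarrow> 'v set \<Rightarrow> ('e \<Rightarrow> 'g) \<Rightarrow> ('v, 'e) pre_digraph \<Rightarrow> ('g, 'b) monoid_scheme" where
  "gain_group \<Gamma> V0 \<psi> H =
     subgroup_generated \<Gamma>
       {walk_gain \<Gamma> \<psi> w | v w. gwalk H v w v \<and> insert v (step_to H ` set w) \<inter> V0 = {}}"

definition balanced ::
  "('g, 'b) monoid_scheme \<Rightarrow> 'v set \<Rightarrow> ('e \<Rightarrow> 'g) \<Rightarrow> ('v, 'e) pre_digraph \<Rightarrow> bool" where
  "balanced \<Gamma> V0 \<psi> H \<longleftrightarrow> carrier (gain_group \<Gamma> V0 \<psi> H) = {\<one>\<^bsub>\<Gamma>\<^esub>}"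

definition near_balanced ::
  "('g, 'b) monoid_scheme \<Rightarrow> 'v set \<Rightarrow> ('e \<Rightarrow> 'g) \<Rightarrow> ('v, 'e) pre_digraph \<Rightarrow> bool" where
  "near_balanced \<Gamma> V0 \<psi> H \<longleftrightarrow> V0 \<inter> verts H = {} \<and> \<not> balanced \<Gamma> V0 \<psi> H \<and>
     (\<exists>v\<in>verts H. \<exists>\<delta>\<in>carrier \<Gamma>. \<forall>w.
        gwalk H v w v \<and> v \<notin> step_to H ` set (butlast w) \<longrightarrow>
        walk_gain \<Gamma> \<psi> w \<in> {\<one>\<^bsub>\<Gamma>\<^esub>, \<delta>, inv\<^bsub>\<Gamma>\<^esub> \<delta>})"

definition proper_near_balanced ::
  "('g, 'b) monoid_scheme \<Rightarrow> 'v set \<Rightarrow> ('e \<Rightarrow> 'g) \<Rightarrow> ('v, 'e) pre_digraph \<Rightarrow> bool" where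
  "proper_near_balanced \<Gamma> V0 \<psi> H \<longleftrightarrow> near_balanced \<Gamma> V0 \<psi> H \<and>
     \<not> gain_group \<Gamma> V0 \<psi> H \<cong> integer_mod_group 2 \<and>
     \<not> gain_group \<Gamma> V0 \<psi> H \<cong> integer_mod_group 3"


section \<open>Sparsity\<close>

definition sparse :: "'v set \<Rightarrow> int \<Rightarrow> int \<Rightarrow> ('v, 'e) pre_digraph \<Rightarrow> bool" where
  "sparse V0 m l G \<longleftrightarrow> (\<forall>H. subgraph H G \<and> arcs H \<noteq> {} \<longrightarrow>
     int (card (arcs H)) \<le> 2 * int (card (verts H - V0)) + m * int (card (V0 \<inter> verts H)) - l)"

definition tight :: "'v set \<Rightarrow> int \<Rightarrow> int \<Rightarrow> ('v, 'e) pre_digraph \<Rightarrow> bool" where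
  "tight V0 m l G \<longleftrightarrow> sparse V0 m l G \<and>
     int (card (arcs G)) = 2 * int (card (verts G - V0)) + m * int (card (V0 \<inter> verts G)) - l"

text \<open>\<open>(2,m,3,l)\<close>-gain-sparsity and \<open>(2,m,3,l)\<close>-gain-tightness; \<open>(2,3)\<close>-sparse is
  \<open>(2,2,3)\<close>-sparse.\<close>

definition gain_sparse ::
  "('g, 'b) monoid_scheme \<Rightarrow> 'v set \<Rightarrow> ('e \<Rightarrow> 'g) \<Rightarrow> int \<Rightarrow> int \<Rightarrow> ('v, 'e) pre_digraph \<Rightarrow> bool" where
  "gain_sparse \<Gamma> V0 \<psi> m l G \<longleftrightarrow> sparse V0 m l G \<and>
     (\<forall>H. subgraph H G \<and> arcs H \<noteq> {} \<and> balanced \<Gamma> V0 \<psi> H \<longrightarrow> sparse V0 2 3 H)"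

definition gain_tight ::
  "('g, 'b) monoid_scheme \<Rightarrow> 'v set \<Rightarrow> ('e \<Rightarrow> 'g) \<Rightarrow> int \<Rightarrow> int \<Rightarrow> ('v, 'e) pre_digraph \<Rightarrow> bool" where
  "gain_tight \<Gamma> V0 \<psi> m l G \<longleftrightarrow> gain_sparse \<Gamma> V0 \<psi> m l G \<and> tight V0 m l G"

definition S_set :: "int \<Rightarrow> nat \<Rightarrow> nat \<Rightarrow> nat set" where
  "S_set i k j = {n. 2 \<le> n \<and> n dvd k \<and> int j mod int n = i mod int n \<and> (odd j \<longrightarrow> n \<noteq> 2)}"

definition alpha ::
  "('g, 'b) monoid_scheme \<Rightarrow> 'v set \<Rightarrow> ('e \<Rightarrow> 'g) \<Rightarrow> nat \<Rightarrow> nat \<Rightarrow> ('v, 'e) pre_digraph \<Rightarrow> int" where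
  "alpha \<Gamma> V0 \<psi> k j K =
     (let c = int (card (V0 \<inter> verts K)); A = gain_group \<Gamma> V0 \<psi> K in
      if balanced \<Gamma> V0 \<psi> K then 0
      else if odd j \<and> A \<cong> integer_mod_group 2 then 1
      else if \<exists>n \<in> S_set (-1) k j \<union> S_set 1 k j. A \<cong> integer_mod_group n then 2 - c
      else if (\<exists>n \<in> S_set 0 k j. A \<cong> integer_mod_group n) \<or>
              (V0 \<inter> verts K = {} \<and> proper_near_balanced \<Gamma> V0 \<psi> K) then 2 - 2 * c
      else 3 - 2 * c)"

definition edge_subgraph :: "('v, 'e) pre_digraph \<Rightarrow> 'e set \<Rightarrow> ('v, 'e) pre_digraph" where
  "edge_subgraph G F = \<lparr>verts = tail G ` F \<union> head G ` F, arcs = F, tail = tail G, head = head G\<rparr>"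

definition components :: "('v, 'e) pre_digraph \<Rightarrow> ('v, 'e) pre_digraph set" where
  "components H = {H \<restriction> {u. \<exists>w. gwalk H v w u} | v. v \<in> verts H}"

definition f_count ::
  "('g, 'b) monoid_scheme \<Rightarrow> 'v set \<Rightarrow> ('e \<Rightarrow> 'g) \<Rightarrow> nat \<Rightarrow> nat \<Rightarrow> ('v, 'e) pre_digraph \<Rightarrow> 'e set \<Rightarrow> int" where
  "f_count \<Gamma> V0 \<psi> k j G F =
     (\<Sum>K\<in>components (edge_subgraph G F). 2 * int (card (verts K)) - 3 + alpha \<Gamma> V0 \<psi> k j K)"

definition Zkj_sparse ::
  "('g, 'b) monoid_scheme \<Rightarrow> 'v set \<Rightarrow> ('e \<Rightarrow> 'g) \<Rightarrow> nat \<Rightarrow> nat \<Rightarrow> ('v, 'e) pre_digraph \<Rightarrow> bool" where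
  "Zkj_sparse \<Gamma> V0 \<psi> k j G \<longleftrightarrow> (\<forall>H. subgraph H G \<and> arcs H \<noteq> {} \<longrightarrow>
     int (card (arcs H)) \<le> f_count \<Gamma> V0 \<psi> k j G (arcs H))"

definition Zkj_tight ::
  "('g, 'b) monoid_scheme \<Rightarrow> 'v set \<Rightarrow> ('e \<Rightarrow> 'g) \<Rightarrow> nat \<Rightarrow> nat \<Rightarrow> ('v, 'e) pre_digraph \<Rightarrow> bool" where
  "Zkj_tight \<Gamma> V0 \<psi> k j G \<longleftrightarrow> Zkj_sparse \<Gamma> V0 \<psi> k j G \<and> card (arcs G) = 2 * card (verts G - V0)"


section \<open>The two gain graphs\<close>

datatype vertexA = VA
datatype edgeA = FA1 | FA2

definition G_A :: "(vertexA, edgeA) pre_digraph" where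
  "G_A = \<lparr>verts = {VA}, arcs = {FA1, FA2}, tail = (\<lambda>_. VA), head = (\<lambda>_. VA)\<rparr>"

definition V0_A :: "vertexA set" where
  "V0_A = {}"

fun psi_A :: "('g, 'b) monoid_scheme \<Rightarrow> 'g \<Rightarrow> edgeA \<Rightarrow> 'g" where
  "psi_A \<Gamma> \<gamma> FA1 = \<gamma>"
| "psi_A \<Gamma> \<gamma> FA2 = \<gamma> [^]\<^bsub>\<Gamma>\<^esub> (3::nat)"

datatype vertexB = UB | VB | V0B
datatype edgeB = FB1 | FB2 | FB3 | EB1 | EB2

fun tail_B :: "edgeB \<Rightarrow> vertexB" where
  "tail_B FB1 = UB" | "tail_B FB2 = UB" | "tail_B FB3 = VB" | "tail_B EB1 = UB" | "tail_B EB2 = VB"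

fun head_B :: "edgeB \<Rightarrow> vertexB" where
  "head_B FB1 = UB" | "head_B FB2 = UB" | "head_B FB3 = VB" | "head_B EB1 = VB" | "head_B EB2 = V0B"

definition G_B :: "(vertexB, edgeB) pre_digraph" where
  "G_B = \<lparr>verts = {UB, VB, V0B}, arcs = {FB1, FB2, FB3, EB1, EB2}, tail = tail_B, head = head_B\<rparr>"

definition V0_B :: "vertexB set" where
  "V0_B = {V0B}"

fun psi_B :: "('g, 'b) monoid_scheme \<Rightarrow> 'g \<Rightarrow> edgeB \<Rightarrow> 'g" where
  "psi_B \<Gamma> \<gamma> FB1 = \<gamma>"
| "psi_B \<Gamma> \<gamma> FB2 = \<gamma> [^]\<^bsub>\<Gamma>\<^esub> (3::nat)"
| "psi_B \<Gamma> \<gamma> FB3 = \<gamma> [^]\<^bsub>\<Gamma>\<^esub> (2::nat)"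
| "psi_B \<Gamma> \<gamma> EB1 = \<one>\<^bsub>\<Gamma>\<^esub>"
| "psi_B \<Gamma> \<gamma> EB2 = \<one>\<^bsub>\<Gamma>\<^esub>"

end

theory Submission
  imports Defs
begin

text \<open>
  Since \<open>k\<close> is even, prescribing a velocity \<open>\<xi> v\<close> at each free vertex \<open>(v, id)\<close> and zero at the fixed
  vertex extends uniquely to a \<open>\<rho>\<close>-symmetric assignment for \<open>j = k/2\<close>, namely
  \<open>m(\<gamma>\<^sup>t v) = (-1)\<^sup>t C\<^sup>t \<xi> v\<close>, and it is an infinitesimal motion as soon as one representative of each
  edge orbit is respected. A loop of odd gain at \<open>v\<close> only asks that \<open>\<xi> v\<close> be parallel to \<open>p v\<close>, so the
  loops with gains \<open>\<gamma>\<close> and \<open>\<gamma>\<^sup>3\<close> impose the same condition although the counts treat them as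
  independent. In (A) this leaves the motion \<open>\<xi> v = p v\<close>. In (B), with \<open>p u = a\<close>, \<open>p v = b\<close> and
  \<open>p v\<^sub>0 = 0\<close>, put \<open>\<xi> u = s a\<close> and let \<open>\<xi> v\<close> be \<open>r\<close> times \<open>b\<close> turned by a right angle; the one
  remaining edge \<open>uv\<close> is a single linear condition on \<open>(s, r)\<close>.

  For \<open>(2,0,3,1)\<close>, \<open>(2,1,3,1)\<close> and \<open>\<int>\<^sub>k\<^sup>j\<close>, tight spanning subgraphs have the edge sets
  \<open>{f\<^sub>1}\<close>, \<open>{f\<^sub>1}\<close>, \<open>{f\<^sub>1, f\<^sub>2}\<close> in (A) and
  \<open>{f\<^sub>1, e\<^sub>1, e\<^sub>2}\<close>, \<open>{f\<^sub>1, f\<^sub>3, e\<^sub>1, e\<^sub>2}\<close>, \<open>{f\<^sub>1, f\<^sub>2, e\<^sub>1, e\<^sub>2}\<close> in (B).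
\<close>

section \<open>Rotations of the plane\<close>

lemma rotation_mult_vec:
  "(rotation \<theta> *v x) $ 1 = cos \<theta> * x $ 1 - sin \<theta> * x $ 2"
  "(rotation \<theta> *v x) $ 2 = sin \<theta> * x $ 1 + cos \<theta> * x $ 2"
  by (simp_all add: rotation_def matrix_vector_mult_def sum_2)

lemma vec2_eq_iff: "(x :: real^2) = y \<longleftrightarrow> x $ 1 = y $ 1 \<and> x $ 2 = y $ 2"
  by (simp add: vec_eq_iff forall_2)

lemma inner_vec2: "(x :: real^2) \<bullet> y = x $ 1 * y $ 1 + x $ 2 * y $ 2"
  by (simp add: inner_vec_def sum_2)

lemma rotation_add: "rotation (\<theta> + \<phi>) *v x = rotation \<theta> *v (rotation \<phi> *v x)"
  by (simp add: vec2_eq_iff rotation_mult_vec cos_add sin_add algebra_simps)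

lemma rotation_zero [simp]: "rotation 0 *v x = x"
  by (simp add: vec2_eq_iff rotation_mult_vec)

lemma rotation_inner: "(rotation \<theta> *v x) \<bullet> (rotation \<theta> *v y) = x \<bullet> y"
proof -
  have "(rotation \<theta> *v x) \<bullet> (rotation \<theta> *v y) = ((cos \<theta>)\<^sup>2 + (sin \<theta>)\<^sup>2) * (x \<bullet> y)"
    by (simp only: inner_vec2 rotation_mult_vec vector_minus_component vector_add_component
        vector_scaleR_component real_scaleR_def) Groebner_Basis.algebra
  then show ?thesis by simp
qed

text \<open>The cross product of \<open>x\<close> with its rotated copy is
  \<open>sin \<theta>\<close> times the squared length of \<open>x\<close>, and it vanishes if the
  copy is \<open>x\<close> itself. This will place the fixed vertex at the origin.\<close>

lemma rotation_fixed_point: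
  assumes "rotation \<theta> *v x = x" "sin \<theta> \<noteq> 0"
  shows "x = 0"
proof -
  have eq: "cos \<theta> * x $ 1 - sin \<theta> * x $ 2 = x $ 1" "sin \<theta> * x $ 1 + cos \<theta> * x $ 2 = x $ 2"
    using assms(1) rotation_mult_vec[of \<theta> x] by simp_all
  have "sin \<theta> * (x $ 1 * x $ 1 + x $ 2 * x $ 2) = 0"
    using arg_cong[OF eq(1), of "\<lambda>t. x $ 2 * t"] arg_cong[OF eq(2), of "\<lambda>t. x $ 1 * t"]
    by (simp add: algebra_simps)
  then show ?thesis
    using assms(2) by (simp add: vec2_eq_iff sum_squares_eq_zero_iff)
qed

definition perp :: "real^2 \<Rightarrow> real^2" where
  "perp a = vector [- a $ 2, a $ 1]"

lemma perp_nth: "perp a $ 1 = - a $ 2" "perp a $ 2 = a $ 1"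
  by (simp_all add: perp_def)

text \<open>The diagonals of the rhombus spanned by \<open>a\<close> and its rotated copy are
  orthogonal. An odd gain carries the sign -1, which turns the difference of the two velocities into
  a sum.\<close>

lemma rotation_loop_odd:
  "(a - rotation \<theta> *v a) \<bullet> (s *\<^sub>R a + rotation \<theta> *v (s *\<^sub>R a)) = 0"
proof -
  \<comment> \<open>Keeping the sum of squares of cosine and sine unsimplified makes this a
    polynomial identity; its value 1 enters only afterwards.\<close>
  have "(a - rotation \<theta> *v a) \<bullet> (s *\<^sub>R a + rotation \<theta> *v (s *\<^sub>R a))
      = s * (1 - ((cos \<theta>)\<^sup>2 + (sin \<theta>)\<^sup>2)) * (a \<bullet> a)"
    by (simp only: inner_vec2 rotation_mult_vec vector_minus_component vector_add_component
        vector_scaleR_component real_scaleR_def) Groebner_Basis.algebra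
  then show ?thesis by simp
qed

text \<open>\<open>perp b\<close> is the velocity of \<open>b\<close> under rotation about the
  origin. Turning by a right angle commutes with rotations, so the velocity difference is
  \<open>r\<close> times the position difference turned by a right angle.\<close>

lemma rotation_loop_even:
  "(b - rotation \<theta> *v b) \<bullet> (r *\<^sub>R perp b - rotation \<theta> *v (r *\<^sub>R perp b)) = 0"
  by (simp add: inner_vec2 rotation_mult_vec perp_nth algebra_simps)

lemma rotation_perp_odd:
  "(b - rotation \<theta> *v b) \<bullet> (r *\<^sub>R perp b + rotation \<theta> *v (r *\<^sub>R perp b)) = - 2 * r * sin \<theta> * (b \<bullet> b)"
  by (simp add: inner_vec2 rotation_mult_vec perp_nth algebra_simps)

text \<open>A skew matrix maps every vector to an orthogonal one. As the pair need not be an edge,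
  non-triviality can be tested on any two vertices.\<close>

lemma trivial_motion_inner:
  assumes "trivial_motion G p m" "u \<in> sverts G" "v \<in> sverts G"
  shows "(p u - p v) \<bullet> (m u - m v) = 0"
proof -
  obtain M :: "real^2^2" and t where M: "transpose M = - M"
    and m: "m u = M *v p u + t" "m v = M *v p v + t"
    using assms unfolding trivial_motion_def by blast
  have M0: "M $ 1 $ 1 = 0" "M $ 2 $ 2 = 0" "M $ 2 $ 1 = - M $ 1 $ 2"
    using arg_cong[OF M, of "\<lambda>N. N $ 1 $ 1"] arg_cong[OF M, of "\<lambda>N. N $ 2 $ 2"]
      arg_cong[OF M, of "\<lambda>N. N $ 1 $ 2"] by (simp_all add: transpose_def)
  have "m u - m v = M *v (p u - p v)"
    using m by (simp add: matrix_vector_mult_diff_distrib)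
  then show ?thesis
    by (simp add: inner_vec2 matrix_vector_mult_def sum_2 M0)
qed


section \<open>Symmetric motions of liftings\<close>

locale cyclic_rotation_group = group \<Gamma> for \<Gamma> :: "('g, 'b) monoid_scheme" (structure) +
  fixes \<gamma> :: 'g and k :: nat
  assumes k_ge: "8 \<le> k" and k_even: "even k"
    and gen_closed [simp]: "\<gamma> \<in> carrier \<Gamma>"
    and carrier_eq: "carrier \<Gamma> = generate \<Gamma> {\<gamma>}"
    and order_eq: "order \<Gamma> = k"
begin

section \<open>The cyclic group, its rotations and its sign character\<close>

lemma finite_carrier [simp]: "finite (carrier \<Gamma>)"
  using order_eq k_ge by (metis card.infinite not_numeral_le_zero order_def)

lemma ord_gen: "ord \<gamma> = k"
  using generate_pow_card[OF gen_closed] carrier_eq order_eq by (metis order_def)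

lemma gen_pow_eq_one: "\<gamma> [^] (n::nat) = \<one> \<longleftrightarrow> k dvd n"
  using pow_eq_id[of \<gamma> n] ord_gen by simp

lemma gen_pow_cases:
  assumes "g \<in> carrier \<Gamma>" obtains t :: nat where "g = \<gamma> [^] t"
proof -
  have "g \<in> {\<gamma> [^] t |t. t \<in> (UNIV :: nat set)}"
    using assms carrier_eq generate_pow_nat[OF gen_closed] ord_gen k_ge by simp
  then show ?thesis using that by auto
qed

lemma tau_pow: "tau \<Gamma> \<gamma> (\<gamma> [^] (t::nat)) = rotation (2 * pi * real t / real k)"
  using tau_rho_pow(1)[OF group_axioms gen_closed carrier_eq finite_carrier] order_eq by simp

lemma rho_half_pow: "rho \<Gamma> \<gamma> (k div 2) (\<gamma> [^] (t::nat)) = (-1) ^ t"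
proof -
  \<comment> \<open>Evenness makes the truncating division exact, so the exponent becomes
    \<open>t\<close> times \<open>\<pi> i\<close>.\<close>
  have "real (k div 2) * 2 = real k"
    using k_even by auto
  then have "2 * complex_of_real pi * \<i> * of_nat (k div 2) * of_nat t / of_nat k = of_nat t * (complex_of_real pi * \<i>)"
    using k_ge k_even by (auto elim!: evenE)
  then show ?thesis
    using tau_rho_pow(2)[OF group_axioms gen_closed carrier_eq finite_carrier] order_eq
    by (simp add: exp_of_nat_mult)
qed

lemma tau_rotation: obtains \<theta> where "tau \<Gamma> \<gamma> g = rotation \<theta>"
  by (simp add: tau_def)

text \<open>\<open>tau\<close> is defined through least exponents, but \<open>tau_pow\<close> holds
  for all exponents, so they can be added without reduction modulo \<open>k\<close>.\<close>

lemma tau_mult: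
  assumes "g \<in> carrier \<Gamma>" "h \<in> carrier \<Gamma>"
  shows "tau \<Gamma> \<gamma> (g \<otimes> h) *v x = tau \<Gamma> \<gamma> g *v (tau \<Gamma> \<gamma> h *v x)"
proof -
  obtain s t :: nat where g: "g = \<gamma> [^] s" and h: "h = \<gamma> [^] t"
    using assms gen_pow_cases by metis
  have "2 * pi * real (s + t) / real k = 2 * pi * real s / real k + 2 * pi * real t / real k"
    by (simp add: add_divide_distrib algebra_simps)
  then show ?thesis
    by (simp add: g h nat_pow_mult tau_pow rotation_add)
qed

text \<open>The character \<open>\<rho>\<^bsub>k/2\<^esub>\<close> is real-valued: it sends \<open>\<gamma>\<^sup>t\<close> to \<open>(-1)\<^sup>t\<close>.\<close>

definition sign :: "'g \<Rightarrow> real" where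
  "sign g = Re (rho \<Gamma> \<gamma> (k div 2) g)"

lemma sign_pow: "sign (\<gamma> [^] (t::nat)) = (-1) ^ t"
proof -
  have "(- 1 :: complex) ^ t = complex_of_real ((- 1) ^ t)" by simp
  then show ?thesis unfolding sign_def rho_half_pow by (metis Re_complex_of_real)
qed

lemma rho_half_sign:
  assumes "g \<in> carrier \<Gamma>" shows "rho \<Gamma> \<gamma> (k div 2) g = of_real (sign g)"
proof -
  obtain t :: nat where g: "g = \<gamma> [^] t"
    using assms gen_pow_cases by metis
  show ?thesis unfolding g sign_pow rho_half_pow by simp
qed

lemma sign_mult: "g \<in> carrier \<Gamma> \<Longrightarrow> h \<in> carrier \<Gamma> \<Longrightarrow> sign (g \<otimes> h) = sign g * sign h"
  by (metis gen_pow_cases gen_closed nat_pow_mult power_add sign_pow)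

lemma sign_one [simp]: "sign \<one> = 1"
  using sign_pow[of 0] by simp

lemma tau_one [simp]: "tau \<Gamma> \<gamma> \<one> *v x = x"
  using tau_pow[of 0] by simp

definition half_motion :: "('v \<Rightarrow> real^2) \<Rightarrow> ('v, 'g) lvertex \<Rightarrow> real^2" where
  "half_motion \<xi> w = (case w of Free v g \<Rightarrow> sign g *\<^sub>R (tau \<Gamma> \<gamma> g *v \<xi> v) | Fixed v \<Rightarrow> 0)"

lemma half_motion_lift_act:
  assumes "\<delta> \<in> carrier \<Gamma>" "w \<in> sverts (lifting \<Gamma> V0 \<psi> G)"
  shows "half_motion \<xi> (lift_act \<Gamma> \<delta> w) = sign \<delta> *\<^sub>R (tau \<Gamma> \<gamma> \<delta> *v half_motion \<xi> w)"
proof (cases w)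
  case (Free v g)
  with assms(2) have "g \<in> carrier \<Gamma>" by (auto simp: lifting_def lvert_def split: if_splits)
  with Free assms(1) show ?thesis
    by (simp add: half_motion_def sign_mult tau_mult scaleR_matrix_vector_assoc[symmetric]
        matrix_vector_mult_scaleR)
qed (simp add: half_motion_def)

text \<open>The values of the character are real here, so the complex conjugation in the definition
  disappears.\<close>

lemma half_motion_rho_symmetric:
  "rho_symmetric \<Gamma> \<gamma> (lift_act \<Gamma>) (lifting \<Gamma> V0 \<psi> G) (k div 2) (half_motion \<xi>)"
  unfolding rho_symmetric_def by (simp add: half_motion_lift_act rho_half_sign)

lemma lvert_in_lifting:
  "v \<in> verts G \<Longrightarrow> g \<in> carrier \<Gamma> \<Longrightarrow> lvert V0 v g \<in> sverts (lifting \<Gamma> V0 \<psi> G)"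
  by (auto simp: lifting_def)

text \<open>Every lifted edge is a translate by some \<open>g\<close> of the lift starting at
  \<open>\<one>\<close>. The translation rotates the position difference and, up to the factor
  \<open>sign g\<close>, the velocity difference by the same angle, so their inner product changes
  only by that factor.\<close>

lemma half_motion_inf_motion:
  assumes sym: "Ck_symmetric \<Gamma> \<gamma> (lift_act \<Gamma>) (lifting \<Gamma> V0 \<psi> G) p"
    and G: "gain_graph \<Gamma> V0 \<psi> G"
    and edge: "\<And>e. e \<in> arcs G \<Longrightarrow>
      (p (lvert V0 (tail G e) \<one>) - p (lvert V0 (head G e) (\<psi> e))) \<bullet>
      (half_motion \<xi> (lvert V0 (tail G e) \<one>) - half_motion \<xi> (lvert V0 (head G e) (\<psi> e))) = 0"
  shows "inf_motion (lifting \<Gamma> V0 \<psi> G) p (half_motion \<xi>)"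
proof -
  let ?L = "lifting \<Gamma> V0 \<psi> G"
  interpret fin_digraph G using G by (simp add: gain_graph_def)
  have psi: "\<psi> e \<in> carrier \<Gamma>" if "e \<in> arcs G" for e
    using G that by (auto simp: gain_graph_def)
  have main: "(p a - p b) \<bullet> (half_motion \<xi> a - half_motion \<xi> b) = 0"
    if e: "e \<in> arcs G" and g: "g \<in> carrier \<Gamma>"
      and a: "a = lvert V0 (tail G e) g" and b: "b = lvert V0 (head G e) (g \<otimes> \<psi> e)" for e g a b
  proof -
    define a' b' where "a' = lvert V0 (tail G e) \<one>" and "b' = lvert V0 (head G e) (\<psi> e)"
    have mem: "a' \<in> sverts ?L" "b' \<in> sverts ?L"
      using e psi[OF e] unfolding a'_def b'_def by (auto intro!: lvert_in_lifting)
    have ab: "a = lift_act \<Gamma> g a'" "b = lift_act \<Gamma> g b'"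
      using g by (simp_all add: a b a'_def b'_def lvert_def)
    obtain \<theta> where \<theta>: "tau \<Gamma> \<gamma> g = rotation \<theta>" by (rule tau_rotation)
    have p: "p a = rotation \<theta> *v p a'" "p b = rotation \<theta> *v p b'"
      using sym g mem unfolding Ck_symmetric_def ab \<theta>[symmetric] by auto
    have m: "half_motion \<xi> a = sign g *\<^sub>R (rotation \<theta> *v half_motion \<xi> a')"
      "half_motion \<xi> b = sign g *\<^sub>R (rotation \<theta> *v half_motion \<xi> b')"
      using g mem unfolding ab \<theta>[symmetric] by (simp_all add: half_motion_lift_act)
    have "(p a - p b) \<bullet> (half_motion \<xi> a - half_motion \<xi> b)
        = sign g * ((p a' - p b') \<bullet> (half_motion \<xi> a' - half_motion \<xi> b'))"
      unfolding p m scaleR_diff_right[symmetric] matrix_vector_mult_diff_distrib[symmetric]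
      by (simp add: rotation_inner)
    then show ?thesis using edge[OF e] by (simp add: a'_def b'_def)
  qed
  show ?thesis
    unfolding inf_motion_def
  proof (intro allI impI)
    fix u v assume "{u, v} \<in> sedges ?L"
    then obtain e g where e: "e \<in> arcs G" "g \<in> carrier \<Gamma>"
      and uv: "{u, v} = {lvert V0 (tail G e) g, lvert V0 (head G e) (g \<otimes> \<psi> e)}"
      by (auto simp: lifting_def)
    show "(p u - p v) \<bullet> (half_motion \<xi> u - half_motion \<xi> v) = 0"
    \<comment> \<open>An unordered edge may list its ends in either order; swapping them negates
      both factors.\<close>
    proof (cases "u = lvert V0 (tail G e) g \<and> v = lvert V0 (head G e) (g \<otimes> \<psi> e)")
      case False
      then have "(p v - p u) \<bullet> (half_motion \<xi> v - half_motion \<xi> u) = 0"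
        using uv by (intro main[OF e]) (auto simp: doubleton_eq_iff)
      then show ?thesis by (simp add: inner_diff_left inner_diff_right)
    qed (use main[OF e] in blast)
  qed
qed

section \<open>Vertex positions and tests for non-triviality\<close>

lemma Ck_symmetric_Free:
  assumes "Ck_symmetric \<Gamma> \<gamma> (lift_act \<Gamma>) (lifting \<Gamma> V0 \<psi> G) p" "v \<in> verts G" "v \<notin> V0"
    and "g \<in> carrier \<Gamma>"
  shows "p (Free v g) = tau \<Gamma> \<gamma> g *v p (Free v \<one>)"
proof -
  have "Free v \<one> \<in> sverts (lifting \<Gamma> V0 \<psi> G)"
    using assms(2,3) by (auto simp: lifting_def lvert_def intro!: exI[of _ v] exI[of _ \<one>])
  then show ?thesis using assms unfolding Ck_symmetric_def by fastforce
qed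

lemma Free_in_lifting:
  "v \<in> verts G \<Longrightarrow> v \<notin> V0 \<Longrightarrow> g \<in> carrier \<Gamma> \<Longrightarrow> Free v g \<in> sverts (lifting \<Gamma> V0 \<psi> G)"
  using lvert_in_lifting[of v G g V0] by (simp add: lvert_def)

lemma sin_base_pos: "sin (2 * pi / real k) > 0"
  using k_ge by (intro sin_gt_zero) (auto simp: field_simps)

lemma Ck_symmetric_Fixed:
  assumes "Ck_symmetric \<Gamma> \<gamma> (lift_act \<Gamma>) (lifting \<Gamma> V0 \<psi> G) p" "v \<in> verts G" "v \<in> V0"
  shows "p (Fixed v) = 0"
proof (rule rotation_fixed_point)
  have "Fixed v \<in> sverts (lifting \<Gamma> V0 \<psi> G)"
    using assms(2,3) by (auto simp: lifting_def lvert_def intro!: exI[of _ v])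
  then have "tau \<Gamma> \<gamma> \<gamma> *v p (Fixed v) = p (Fixed v)"
    using assms(1) unfolding Ck_symmetric_def by fastforce
  then show "rotation (2 * pi / real k) *v p (Fixed v) = p (Fixed v)"
    using tau_pow[of 1] by simp
qed (use sin_base_pos in simp)

lemma gen_pow_inj:
  assumes "m < k" "n < k" "\<gamma> [^] (m::nat) = \<gamma> [^] (n::nat)" shows "m = n"
proof -
  have "inj_on (\<lambda>i::nat. \<gamma> [^] i) {0..k - 1}"
    using ord_inj[OF gen_closed] ord_gen by simp
  then show ?thesis
    using assms by (auto dest: inj_onD)
qed

text \<open>Since \<open>\<gamma>^2\<close> has sign +1, the copies of \<open>v\<close> at
  \<open>\<one>\<close> and \<open>\<gamma>^2\<close> both move by \<open>s\<close> times their
  position. Their distance is therefore stretched, which no trivial motion does.\<close>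

lemma radial_motion_nontrivial:
  assumes sym: "Ck_symmetric \<Gamma> \<gamma> (lift_act \<Gamma>) (lifting \<Gamma> V0 \<psi> G) p"
    and v: "v \<in> verts G" "v \<notin> V0" and \<xi>: "\<xi> v = s *\<^sub>R p (Free v \<one>)" "s \<noteq> 0"
  shows "\<not> trivial_motion (lifting \<Gamma> V0 \<psi> G) p (half_motion \<xi>)"
proof
  let ?L = "lifting \<Gamma> V0 \<psi> G"
  let ?g = "\<gamma> [^] (2::nat)"
  assume triv: "trivial_motion ?L p (half_motion \<xi>)"
  have mem: "Free v \<one> \<in> sverts ?L" "Free v ?g \<in> sverts ?L"
    using v by (auto intro: Free_in_lifting)
  have "\<one> \<noteq> ?g" using gen_pow_inj[of 0 2] k_ge by auto
  then have ne: "p (Free v \<one>) \<noteq> p (Free v ?g)"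
    using sym mem unfolding Ck_symmetric_def framework_def by (auto dest: inj_onD)
  have m: "half_motion \<xi> (Free v \<one>) = s *\<^sub>R p (Free v \<one>)"
    "half_motion \<xi> (Free v ?g) = s *\<^sub>R p (Free v ?g)"
    using \<xi> Ck_symmetric_Free[OF sym v, of ?g]
    by (simp_all add: half_motion_def sign_pow matrix_vector_mult_scaleR)
  from trivial_motion_inner[OF triv mem] have "s *\<^sub>R (p (Free v \<one>) - p (Free v ?g)) = 0"
    unfolding m scaleR_diff_right[symmetric] by simp
  then show False using ne \<xi>(2) by simp
qed

text \<open>Here the test pair must differ by an odd gain, as pairs of even gain keep their distance
  by \<open>rotation_loop_even\<close>. For the copies at \<open>\<one>\<close> and
  \<open>\<gamma>\<close> the inner product is given by \<open>rotation_perp_odd\<close> and is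
  nonzero.\<close>

lemma perp_motion_nontrivial:
  assumes sym: "Ck_symmetric \<Gamma> \<gamma> (lift_act \<Gamma>) (lifting \<Gamma> V0 \<psi> G) p"
    and v: "v \<in> verts G" "v \<notin> V0" and \<xi>: "\<xi> v = r *\<^sub>R perp (p (Free v \<one>))" "r \<noteq> 0"
  shows "\<not> trivial_motion (lifting \<Gamma> V0 \<psi> G) p (half_motion \<xi>)"
proof
  let ?L = "lifting \<Gamma> V0 \<psi> G"
  define b where "b = p (Free v \<one>)"
  assume triv: "trivial_motion ?L p (half_motion \<xi>)"
  have mem: "Free v \<one> \<in> sverts ?L" "Free v \<gamma> \<in> sverts ?L"
    using v by (auto intro: Free_in_lifting)
  have "\<one> \<noteq> \<gamma>" using gen_pow_inj[of 0 1] k_ge by auto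
  then have "b \<noteq> p (Free v \<gamma>)"
    using sym mem unfolding Ck_symmetric_def framework_def b_def by (auto dest: inj_onD)
  moreover have pg: "p (Free v \<gamma>) = rotation (2 * pi / real k) *v b"
    using Ck_symmetric_Free[OF sym v, of \<gamma>] tau_pow[of 1] by (simp add: b_def)
  \<comment> \<open>At the origin \<open>b\<close> would coincide with its rotated copy, against
    injectivity.\<close>
  ultimately have "b \<noteq> 0" by (metis matrix_vector_mult_0_right)
  have m: "half_motion \<xi> (Free v \<one>) = r *\<^sub>R perp b"
    "half_motion \<xi> (Free v \<gamma>) = - (rotation (2 * pi / real k) *v (r *\<^sub>R perp b))"
    using \<xi> sign_pow[of 1] tau_pow[of 1]
    by (simp_all add: half_motion_def b_def)
  from trivial_motion_inner[OF triv mem] have "- 2 * r * sin (2 * pi / real k) * (b \<bullet> b) = 0"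
    unfolding m pg rotation_perp_odd[symmetric] b_def by simp
  then show False using \<open>b \<noteq> 0\<close> \<xi>(2) sin_base_pos by simp
qed

end


section \<open>Gain groups and the function alpha\<close>

context group
begin

lemma subgroup_gain_group: "subgroup (carrier (gain_group G V0 \<psi> K)) G"
  unfolding gain_group_def by (rule subgroup_subgroup_generated)

lemma loop_gain_in_gain_group:
  assumes "e \<in> arcs K" "tail K e = x" "head K e = x" "x \<in> verts K" "x \<notin> V0" "\<psi> e \<in> carrier G"
  shows "\<psi> e \<in> carrier (gain_group G V0 \<psi> K)"
proof -
  have "\<psi> e \<in> {walk_gain G \<psi> w | v w. gwalk K v w v \<and> insert v (step_to K ` set w) \<inter> V0 = {}}"
    by (intro CollectI exI[of _ x] exI[of _ "[(e, True)]"])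
      (use assms in \<open>auto simp: step_from_def step_to_def\<close>)
  then show ?thesis
    unfolding gain_group_def carrier_subgroup_generated using assms(6)
    by (intro generate.incl) blast
qed

lemma loop_unbalanced:
  assumes "e \<in> arcs K" "tail K e = x" "head K e = x" "x \<in> verts K" "x \<notin> V0" "\<psi> e \<in> carrier G"
    and "\<psi> e \<noteq> \<one>"
  shows "\<not> balanced G V0 \<psi> K"
  using loop_gain_in_gain_group[where \<psi> = \<psi>, OF assms(1-6)] assms(7) by (auto simp: balanced_def)

text \<open>\<open>\<one>\<close>, \<open>g\<close> and \<open>inv g\<close> are distinct
  members.\<close>

lemma subgroup_card_ge_3:
  assumes "subgroup S G" "finite S" "g \<in> S" "g \<noteq> \<one>" "g \<otimes> g \<noteq> \<one>"
  shows "3 \<le> card S"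
proof -
  have g: "g \<in> carrier G" using assms subgroup.subset by blast
  have "inv g \<noteq> \<one>" using g assms(4) by (metis inv_inv inv_one)
  moreover have "inv g \<noteq> g" using g assms(5) by (metis r_inv)
  ultimately have "card {\<one>, g, inv g} = 3" using assms(4) by auto
  moreover have "{\<one>, g, inv g} \<subseteq> S"
    using assms(3) subgroup.one_closed[OF assms(1)] subgroup.m_inv_closed[OF assms(1,3)] by simp
  ultimately show ?thesis using card_mono[OF assms(2)] by metis
qed

end

text \<open>Isomorphisms are only ever ruled out below, and comparing orders does that. The case
  \<open>n = 0\<close> fits because the infinite carrier has \<open>card\<close> 0.\<close>

lemma iso_integer_mod_group_card: "A \<cong> integer_mod_group n \<Longrightarrow> card (carrier A) = n"
  using iso_same_card[of A "integer_mod_group n"] by (simp add: carrier_integer_mod_group split: if_splits)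

lemma alpha_nonneg: "card (V0 \<inter> verts K) \<le> 1 \<Longrightarrow> 0 \<le> alpha \<Gamma> V0 \<psi> k j K"
  by (auto simp: alpha_def Let_def)

text \<open>Away from the fixed vertex only the balanced branch and the branch for order 2 give a
  value below 2, and both force an order below 3.\<close>

lemma alpha_ge_2:
  assumes "V0 \<inter> verts K = {}" "3 \<le> card (carrier (gain_group \<Gamma> V0 \<psi> K))"
  shows "2 \<le> alpha \<Gamma> V0 \<psi> k j K"
proof -
  have "\<not> balanced \<Gamma> V0 \<psi> K" using assms(2) by (auto simp: balanced_def)
  moreover have "\<not> gain_group \<Gamma> V0 \<psi> K \<cong> integer_mod_group 2"
  proof
    assume "gain_group \<Gamma> V0 \<psi> K \<cong> integer_mod_group 2"
    from iso_integer_mod_group_card[OF this] show False using assms(2) by simp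
  qed
  ultimately show ?thesis using assms(1) by (simp add: alpha_def Let_def)
qed

text \<open>Any admissible \<open>n\<close> would have to equal \<open>k\<close>, but
  \<open>j\<close> between 2 and \<open>k - 2\<close> is not congruent to -1, 0 or 1 modulo
  \<open>k\<close>. The last hypothesis excludes the near-balanced branch, so the final branch of
  \<open>alpha\<close> applies.\<close>

lemma alpha_full_gain_group:
  assumes card: "card (carrier (gain_group \<Gamma> V0 \<psi> K)) = k" and k: "3 \<le> k" and j: "2 \<le> j" "j \<le> k - 2"
    and "V0 \<inter> verts K \<noteq> {} \<or> \<not> proper_near_balanced \<Gamma> V0 \<psi> K"
  shows "alpha \<Gamma> V0 \<psi> k j K = 3 - 2 * int (card (V0 \<inter> verts K))"
proof -
  have n: "n = k" if "gain_group \<Gamma> V0 \<psi> K \<cong> integer_mod_group n" for n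
    using iso_integer_mod_group_card[OF that] card by simp
  have jk: "int j mod int k = int j"
    using j k by simp
  have "k \<notin> S_set i k j" if "i \<in> {-1, 0, 1}" for i
    using that j k jk by (auto simp: S_set_def zmod_minus1)
  then have "\<not> (\<exists>n \<in> S_set (-1) k j \<union> S_set 1 k j. gain_group \<Gamma> V0 \<psi> K \<cong> integer_mod_group n)"
    "\<not> (\<exists>n \<in> S_set 0 k j. gain_group \<Gamma> V0 \<psi> K \<cong> integer_mod_group n)"
    using n by blast+
  moreover have "\<not> balanced \<Gamma> V0 \<psi> K" using card k by (auto simp: balanced_def)
  moreover have "\<not> gain_group \<Gamma> V0 \<psi> K \<cong> integer_mod_group 2" using n[of 2] k by auto
  ultimately show ?thesis using assms(5) by (simp add: alpha_def Let_def)
qed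


section \<open>Components\<close>

lemma gwalk_append:
  "gwalk E u w v \<Longrightarrow> gwalk E v w' x \<Longrightarrow> gwalk E u (w @ w') x"
  by (induction w arbitrary: u) auto

lemma gwalk_closed:
  assumes "gwalk E v w u" "v \<in> S" "\<And>e. e \<in> arcs E \<Longrightarrow> tail E e \<in> S \<longleftrightarrow> head E e \<in> S"
  shows "u \<in> S"
  using assms(1,2)
proof (induction w arbitrary: v)
  case (Cons s w)
  then have "step_to E s \<in> S"
    using assms(3)[of "fst s"] by (auto simp: step_from_def step_to_def split: if_splits)
  then show ?case using Cons by auto
qed auto

text \<open>Any two vertices of \<open>S\<close> are joined by a walk through the centre
  \<open>r\<close>, and \<open>closed\<close> keeps walks inside \<open>S\<close>. All components
  met below have this shape, possibly with loops.\<close>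

lemma star_reachable:
  assumes S: "r \<in> S" "S \<subseteq> verts E" "v \<in> S"
    and closed: "\<And>e. e \<in> arcs E \<Longrightarrow> tail E e \<in> S \<longleftrightarrow> head E e \<in> S"
    and star: "\<And>u. u \<in> S \<Longrightarrow> u \<noteq> r \<Longrightarrow> \<exists>e\<in>arcs E. {tail E e, head E e} = {r, u}"
  shows "{u. \<exists>w. gwalk E v w u} = S"
proof -
  have *: "\<exists>w w'. gwalk E r w u \<and> gwalk E u w' r" if u: "u \<in> S" for u
  proof (cases "u = r")
    case True
    then show ?thesis using S by (intro exI[of _ "[]"]) auto
  next
    case False
    then obtain e where e: "e \<in> arcs E" "{tail E e, head E e} = {r, u}"
      using star u by blast
    then consider "tail E e = r" "head E e = u" | "tail E e = u" "head E e = r"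
      by (auto simp: doubleton_eq_iff)
    then show ?thesis
    proof cases
      case 1
      then have "gwalk E r [(e, True)] u" "gwalk E u [(e, False)] r"
        using e S u by (auto simp: step_from_def step_to_def)
      then show ?thesis by blast
    next
      case 2
      then have "gwalk E r [(e, False)] u" "gwalk E u [(e, True)] r"
        using e S u by (auto simp: step_from_def step_to_def)
      then show ?thesis by blast
    qed
  qed
  show ?thesis
  proof (intro equalityI subsetI)
    fix u assume "u \<in> S"
    then obtain w where "gwalk E r w u" using * by blast
    moreover obtain w' where "gwalk E v w' r" using * S(3) by blast
    ultimately show "u \<in> {u. \<exists>w. gwalk E v w u}"
      by (auto intro: gwalk_append)
  next
    fix u assume "u \<in> {u. \<exists>w. gwalk E v w u}"
    then obtain w where "gwalk E v w u" by blast
    then show "u \<in> S" using S(3) closed by (rule gwalk_closed)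
  qed
qed

lemma edge_subgraph_simps [simp]:
  "verts (edge_subgraph G F) = tail G ` F \<union> head G ` F" "arcs (edge_subgraph G F) = F"
  "tail (edge_subgraph G F) = tail G" "head (edge_subgraph G F) = head G"
  by (simp_all add: edge_subgraph_def)

lemma components_image: "components E = (\<lambda>v. E \<restriction> {u. \<exists>w. gwalk E v w u}) ` verts E"
  by (simp add: components_def setcompr_eq_image)

text \<open>Transfers counts from \<open>G_B\<close> to its spanning subgraphs, which differ only in
  their arc sets.\<close>

lemma f_count_cong:
  "tail G = tail H \<Longrightarrow> head G = head H \<Longrightarrow> f_count \<Gamma> V0 \<psi> k j G F = f_count \<Gamma> V0 \<psi> k j H F"
  by (simp add: f_count_def edge_subgraph_def)

text \<open>The star makes the edge subgraph connected, so the sum has a single term.\<close>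

lemma f_count_star:
  assumes V: "V = tail G ` F \<union> head G ` F" "r \<in> V"
    and star: "\<And>u. u \<in> V \<Longrightarrow> u \<noteq> r \<Longrightarrow> \<exists>e\<in>F. {tail G e, head G e} = {r, u}"
  shows "f_count \<Gamma> V0 \<psi> k j G F = 2 * int (card V) - 3 + alpha \<Gamma> V0 \<psi> k j (edge_subgraph G F)"
proof -
  let ?E = "edge_subgraph G F"
  have "{u. \<exists>w. gwalk ?E v w u} = V" if "v \<in> V" for v
    using V that star by (intro star_reachable[where r = r]) auto
  then have "(\<lambda>v. ?E \<restriction> {u. \<exists>w. gwalk ?E v w u}) ` V = {?E \<restriction> V}"
    using V(2) by auto
  then have "components ?E = {?E \<restriction> V}"
    by (simp add: components_image V(1))
  moreover have "?E \<restriction> V = ?E"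
    using V by (auto simp: induce_subgraph_def edge_subgraph_def)
  ultimately show ?thesis by (simp add: f_count_def V(1))
qed

text \<open>Turns cardinalities of subsets of a small set into sums of truth values, so that
  sparsity becomes a finite case check.\<close>

lemma card_eq_sum_of_bool: "finite B \<Longrightarrow> A \<subseteq> B \<Longrightarrow> card A = (\<Sum>x\<in>B. of_bool (x \<in> A))"
  by (simp add: sum.inter_restrict[symmetric] Int_absorb1 Int_absorb2 of_bool_def)

context cyclic_rotation_group
begin

section \<open>Loops with gains \<open>\<gamma>\<close> and \<open>\<gamma>^3\<close>\<close>

lemma gen_pow_neq_one: "0 < n \<Longrightarrow> n < k \<Longrightarrow> \<gamma> [^] (n::nat) \<noteq> \<one>"
  by (auto simp: gen_pow_eq_one dest: dvd_imp_le)

lemma gen_neq_one: "\<gamma> \<noteq> \<one>" "\<gamma> [^] (2::nat) \<noteq> \<one>" "\<gamma> [^] (3::nat) \<noteq> \<one>"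
  using gen_pow_neq_one[of 1] gen_pow_neq_one[of 2] gen_pow_neq_one[of 3] k_ge by auto

lemma gen_cube_neq: "\<gamma> [^] (3::nat) \<noteq> \<gamma>" "\<gamma> [^] (3::nat) \<noteq> inv \<gamma>"
proof -
  show "\<gamma> [^] (3::nat) \<noteq> \<gamma>" using gen_pow_inj[of 3 1] k_ge by auto
  have "\<gamma> [^] (3::nat) \<otimes> \<gamma> = \<gamma> [^] (4::nat)"
    using nat_pow_mult[OF gen_closed, of 3 1] by simp
  then have "\<gamma> [^] (3::nat) \<otimes> \<gamma> \<noteq> \<one>" using gen_pow_neq_one[of 4] k_ge by simp
  then show "\<gamma> [^] (3::nat) \<noteq> inv \<gamma>" by auto
qed

lemma card_gain_group_full:
  assumes "\<gamma> \<in> carrier (gain_group \<Gamma> V0 \<psi> K)"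
  shows "card (carrier (gain_group \<Gamma> V0 \<psi> K)) = k"
proof -
  have "generate \<Gamma> {\<gamma>} \<subseteq> carrier (gain_group \<Gamma> V0 \<psi> K)"
    by (rule generate_subgroup_incl) (use assms subgroup_gain_group in auto)
  then have "carrier (gain_group \<Gamma> V0 \<psi> K) = carrier \<Gamma>"
    using carrier_eq subgroup.subset[OF subgroup_gain_group] by blast
  then show ?thesis using order_eq by (simp add: order_def)
qed

text \<open>The cube generates a proper subgroup when 3 divides \<open>k\<close>, so only a lower
  bound is claimed. It holds because \<open>\<gamma>^6\<close> is still nontrivial for
  \<open>k\<close> at least 8.\<close>

lemma card_gain_group_cube:
  assumes "\<gamma> [^] (3::nat) \<in> carrier (gain_group \<Gamma> V0 \<psi> K)"
  shows "3 \<le> card (carrier (gain_group \<Gamma> V0 \<psi> K))"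
proof (rule subgroup_card_ge_3[OF subgroup_gain_group _ assms])
  show "finite (carrier (gain_group \<Gamma> V0 \<psi> K))"
    using subgroup.subset[OF subgroup_gain_group] finite_carrier by (rule finite_subset)
  have "\<gamma> [^] (3::nat) \<otimes> \<gamma> [^] (3::nat) = \<gamma> [^] (6::nat)"
    by (simp add: nat_pow_mult)
  then show "\<gamma> [^] (3::nat) \<otimes> \<gamma> [^] (3::nat) \<noteq> \<one>"
    using gen_pow_neq_one[of 6] k_ge by simp
qed (rule gen_neq_one)

lemma card_gain_group_loop:
  assumes "e \<in> arcs K" "tail K e = x" "head K e = x" "x \<in> verts K" "x \<notin> V0"
    and "\<psi> e = \<gamma> \<or> \<psi> e = \<gamma> [^] (3::nat)"
  shows "3 \<le> card (carrier (gain_group \<Gamma> V0 \<psi> K))"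
proof -
  have "\<psi> e \<in> carrier (gain_group \<Gamma> V0 \<psi> K)"
    using assms(6) by (intro loop_gain_in_gain_group[OF assms(1-5)]) (metis gen_closed nat_pow_closed)
  then show ?thesis
    using assms(6) card_gain_group_full[of V0 \<psi> K] card_gain_group_cube[of V0 \<psi> K] k_ge by auto
qed

text \<open>Each loop is a closed walk without internal vertices. Both gains are nontrivial, so
  near-balancedness would make them equal or mutually inverse.\<close>

lemma two_loops_not_near_balanced:
  assumes K: "verts K = {x}" and a: "a \<in> arcs K" "tail K a = x" "head K a = x"
    and b: "b \<in> arcs K" "tail K b = x" "head K b = x"
    and gains: "\<psi> a = \<gamma>" "\<psi> b = \<gamma> [^] (3::nat)"
  shows "\<not> near_balanced \<Gamma> V0 \<psi> K"
proof
  assume "near_balanced \<Gamma> V0 \<psi> K"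
  then obtain \<delta> where \<delta>: "\<delta> \<in> carrier \<Gamma>"
    and w: "\<And>w. gwalk K x w x \<Longrightarrow> x \<notin> step_to K ` set (butlast w) \<Longrightarrow>
      walk_gain \<Gamma> \<psi> w \<in> {\<one>, \<delta>, inv \<delta>}"
    using K by (auto simp: near_balanced_def)
  have "\<gamma> \<in> {\<one>, \<delta>, inv \<delta>}" "\<gamma> [^] (3::nat) \<in> {\<one>, \<delta>, inv \<delta>}"
    using w[of "[(a, True)]"] w[of "[(b, True)]"] a b K gains
    by (auto simp: step_from_def step_to_def)
  then show False
    using gen_cube_neq gen_neq_one \<delta> by auto
qed

text \<open>A one-vertex component contributes \<open>2 - 3 + alpha\<close>. Two loops give the full
  gain group without near-balancedness, hence \<open>alpha\<close> = 3; a single loop gives at least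
  2.\<close>

lemma bouquet_count:
  assumes K: "verts K = {x}" "x \<notin> V0" "\<And>e. e \<in> arcs K \<Longrightarrow> tail K e = x \<and> head K e = x"
    and arcs: "arcs K \<subseteq> {a, b}" "arcs K \<noteq> {}"
    and gains: "\<psi> a = \<gamma>" "\<psi> b = \<gamma> [^] (3::nat)" and j: "2 \<le> j" "j \<le> k - 2"
  shows "int (card (arcs K)) \<le> alpha \<Gamma> V0 \<psi> k j K - 1"
proof (cases "a \<in> arcs K \<and> b \<in> arcs K")
  case True
  have "\<not> near_balanced \<Gamma> V0 \<psi> K"
    using True K gains by (intro two_loops_not_near_balanced[where a = a and b = b and x = x]) auto
  moreover have "\<gamma> \<in> carrier (gain_group \<Gamma> V0 \<psi> K)"
    using loop_gain_in_gain_group[of a K x V0 \<psi>] True K gains by auto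
  ultimately have "alpha \<Gamma> V0 \<psi> k j K = 3 - 2 * int (card (V0 \<inter> verts K))"
    using k_ge by (intro alpha_full_gain_group card_gain_group_full j) (auto simp: proper_near_balanced_def)
  moreover have "V0 \<inter> verts K = {}" using K by auto
  moreover have "card (arcs K) \<le> card {a, b}" by (rule card_mono) (use arcs in auto)
  ultimately show ?thesis by (simp add: card_insert_if split: if_splits)
next
  case False
  then obtain c where c: "arcs K = {c}" "c = a \<or> c = b" using arcs by blast
  then have "3 \<le> card (carrier (gain_group \<Gamma> V0 \<psi> K))"
    using K gains by (intro card_gain_group_loop[of c _ x]) auto
  then have "2 \<le> alpha \<Gamma> V0 \<psi> k j K"
    using K by (intro alpha_ge_2) auto
  then show ?thesis using c by simp
qed

end

section \<open>The two gain graphs\<close>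

lemma G_A_simps [simp]:
  "verts G_A = {VA}" "arcs G_A = {FA1, FA2}" "tail G_A = (\<lambda>_. VA)" "head G_A = (\<lambda>_. VA)"
  by (simp_all add: G_A_def)

lemma G_B_simps [simp]:
  "verts G_B = {UB, VB, V0B}" "arcs G_B = {FB1, FB2, FB3, EB1, EB2}" "tail G_B = tail_B" "head G_B = head_B"
  by (simp_all add: G_B_def)

lemma vertexB_eq: "x = UB \<or> x = VB \<or> x = V0B"
  by (cases x) auto

lemma subgraph_arc_ends:
  assumes "subgraph H K" "e \<in> arcs H"
  shows "tail K e \<in> verts H" "head K e \<in> verts H"
  using assms by (auto simp: subgraph_def compatible_def wf_digraph_def)

context cyclic_rotation_group
begin

lemma gain_graph_A: "gain_graph \<Gamma> V0_A (psi_A \<Gamma> \<gamma>) G_A"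
proof -
  have "fin_digraph G_A"
    by unfold_locales auto
  moreover have "\<gamma> \<noteq> inv (\<gamma> [^] (3::nat))"
    using gen_cube_neq by (metis gen_closed inv_inv nat_pow_closed)
  ultimately show ?thesis
    using gen_cube_neq gen_neq_one by (auto simp: gain_graph_def V0_A_def)
qed

lemma gain_graph_B: "gain_graph \<Gamma> V0_B (psi_B \<Gamma> \<gamma>) G_B"
proof -
  have "fin_digraph G_B"
    by unfold_locales auto
  moreover have "\<gamma> \<noteq> inv (\<gamma> [^] (3::nat))"
    using gen_cube_neq by (metis gen_closed inv_inv nat_pow_closed)
  ultimately show ?thesis
    using gen_cube_neq gen_neq_one by (auto simp: gain_graph_def V0_B_def)
qed

section \<open>Tight spanning subgraphs of the first graph\<close>

definition loop_A :: "(vertexA, edgeA) pre_digraph" where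
  "loop_A = G_A\<lparr>arcs := {FA1}\<rparr>"

lemma spanning_loop_A: "spanning loop_A G_A"
  by (auto simp: spanning_def subgraph_def wf_digraph_def compatible_def loop_A_def)

text \<open>Without a fixed vertex \<open>m\<close> multiplies zero, so one proof serves both
  values. The only subgraph with an edge is the unbalanced loop.\<close>

lemma gain_tight_A: "gain_tight \<Gamma> V0_A (psi_A \<Gamma> \<gamma>) m 1 loop_A"
proof -
  have verts: "verts H = {VA}" and arcs: "arcs H = {FA1}" and ends: "tail H FA1 = VA" "head H FA1 = VA"
    if H: "subgraph H loop_A" "arcs H \<noteq> {}" for H
  proof -
    show "arcs H = {FA1}" using H by (auto simp: subgraph_def loop_A_def)
    then show "verts H = {VA}"
      using H subgraph_arc_ends[OF H(1), of FA1] by (auto simp: subgraph_def loop_A_def)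
    have "tail H = tail loop_A" "head H = head loop_A"
      using H by (simp_all add: subgraph_def compatible_def)
    then show "tail H FA1 = VA" "head H FA1 = VA" by (simp_all add: loop_A_def)
  qed
  have "\<not> balanced \<Gamma> V0_A (psi_A \<Gamma> \<gamma>) H" if "subgraph H loop_A" "arcs H \<noteq> {}" for H
    using verts[OF that] arcs[OF that] ends[OF that] gen_neq_one
    by (intro loop_unbalanced[of FA1 _ VA]) (auto simp: V0_A_def)
  moreover have "sparse V0_A m 1 loop_A"
    unfolding sparse_def
  proof (intro allI impI)
    fix H assume H: "subgraph H loop_A \<and> arcs H \<noteq> {}"
    show "int (card (arcs H)) \<le> 2 * int (card (verts H - V0_A)) + m * int (card (V0_A \<inter> verts H)) - 1"
      using H verts[of H] arcs[of H] by (simp add: V0_A_def)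
  qed
  ultimately show ?thesis
    by (auto simp: gain_tight_def gain_sparse_def tight_def V0_A_def loop_A_def)
qed

lemma Zkj_tight_A:
  assumes j: "2 \<le> j" "j \<le> k - 2"
  shows "Zkj_tight \<Gamma> V0_A (psi_A \<Gamma> \<gamma>) k j G_A"
  unfolding Zkj_tight_def Zkj_sparse_def
proof (intro conjI allI impI)
  fix H assume H: "subgraph H G_A \<and> arcs H \<noteq> {}"
  let ?F = "arcs H"
  have F: "?F \<subseteq> {FA1, FA2}" "?F \<noteq> {}" using H by (auto simp: subgraph_def)
  have "f_count \<Gamma> V0_A (psi_A \<Gamma> \<gamma>) k j G_A ?F
      = 2 * int (card {VA}) - 3 + alpha \<Gamma> V0_A (psi_A \<Gamma> \<gamma>) k j (edge_subgraph G_A ?F)"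
    using F by (intro f_count_star[where r = VA]) auto
  moreover have "int (card (arcs (edge_subgraph G_A ?F)))
      \<le> alpha \<Gamma> V0_A (psi_A \<Gamma> \<gamma>) k j (edge_subgraph G_A ?F) - 1"
    using F j by (intro bouquet_count[where x = VA and a = FA1 and b = FA2]) (auto simp: V0_A_def)
  ultimately show "int (card ?F) \<le> f_count \<Gamma> V0_A (psi_A \<Gamma> \<gamma>) k j G_A ?F" by simp
qed (simp add: V0_A_def)

section \<open>Tight spanning subgraphs of the second graph\<close>

lemma spanning_B: "F \<subseteq> arcs G_B \<Longrightarrow> spanning (G_B\<lparr>arcs := F\<rparr>) G_B"
  unfolding spanning_def subgraph_def wf_digraph_def compatible_def
  by (simp add: vertexB_eq)

text \<open>The booleans stand for membership of \<open>f\<^sub>1, f\<^sub>3, e\<^sub>1, e\<^sub>2\<close> and \<open>u, v, v\<^sub>0\<close> in a subgraph.\<close>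

lemma sparse_count_B:
  fixes f1 f3 e1 e2 u v w :: bool and m :: int
  assumes "f1 \<longrightarrow> u" "f3 \<longrightarrow> v" "e1 \<longrightarrow> u \<and> v" "e2 \<longrightarrow> v \<and> w"
    and "f1 \<or> f3 \<or> e1 \<or> e2" "f3 \<longrightarrow> m = 1" "m = 0 \<or> m = 1"
  shows "of_bool f1 + of_bool f3 + of_bool e1 + of_bool e2 \<le> 2 * (of_bool u + of_bool v) + m * of_bool w - 1"
  using assms(7)
proof
  assume "m = 0"
  then show ?thesis
    using assms by (cases f1; cases e1; cases e2; cases u; cases v; cases w) simp_all
next
  assume "m = 1"
  then show ?thesis
    using assms(1-5) by (cases f1; cases f3; cases e1; cases e2; cases u; cases v; cases w) simp_all
qed

text \<open>Without loops there remains at most a path: one edge needs two vertices, and two edges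
  need three.\<close>

lemma balanced_count_B:
  fixes f1 f3 e1 e2 u v w :: bool
  assumes "\<not> f1" "\<not> f3" "e1 \<longrightarrow> u \<and> v" "e2 \<longrightarrow> v \<and> w" "e1 \<or> e2"
  shows "of_bool f1 + of_bool f3 + of_bool e1 + of_bool e2
    \<le> 2 * (of_bool u + of_bool v) + 2 * of_bool w - (3 :: int)"
  using assms by (cases e1; cases e2; cases u; cases v; cases w) simp_all

lemma gain_tight_B:
  assumes m: "m = 0 \<and> F = {FB1, EB1, EB2} \<or> m = 1 \<and> F = {FB1, FB3, EB1, EB2}"
  shows "gain_tight \<Gamma> V0_B (psi_B \<Gamma> \<gamma>) m 1 (G_B\<lparr>arcs := F\<rparr>)"
proof -
  let ?K = "G_B\<lparr>arcs := F\<rparr>"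
  have F: "F \<subseteq> {FB1, FB3, EB1, EB2}" "FB3 \<in> F \<Longrightarrow> m = 1" "m \<in> {0, 1}" using m by auto
  have sub: "subgraph H ?K" if "subgraph H H'" "subgraph H' ?K" for H H'
    using that by (auto simp: subgraph_def compatible_def)
  have ends: "FB1 \<in> arcs H \<Longrightarrow> UB \<in> verts H" "FB3 \<in> arcs H \<Longrightarrow> VB \<in> verts H"
    "EB1 \<in> arcs H \<Longrightarrow> UB \<in> verts H" "EB1 \<in> arcs H \<Longrightarrow> VB \<in> verts H"
    "EB2 \<in> arcs H \<Longrightarrow> VB \<in> verts H" "EB2 \<in> arcs H \<Longrightarrow> V0B \<in> verts H"
    and ts: "tail H = tail_B" "head H = head_B"
    and card_arcs: "card (arcs H) = of_bool (FB1 \<in> arcs H) + of_bool (FB3 \<in> arcs H)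
      + of_bool (EB1 \<in> arcs H) + of_bool (EB2 \<in> arcs H)"
    and card_free: "card (verts H - V0_B) = of_bool (UB \<in> verts H) + of_bool (VB \<in> verts H)"
    and card_fixed: "card (V0_B \<inter> verts H) = of_bool (V0B \<in> verts H)"
    and nonempty: "arcs H \<noteq> {} \<longleftrightarrow> FB1 \<in> arcs H \<or> FB3 \<in> arcs H \<or> EB1 \<in> arcs H \<or> EB2 \<in> arcs H"
    and arcsF: "arcs H \<subseteq> F"
    if H: "subgraph H ?K" for H
  proof -
    show "FB1 \<in> arcs H \<Longrightarrow> UB \<in> verts H" "FB3 \<in> arcs H \<Longrightarrow> VB \<in> verts H"
      "EB1 \<in> arcs H \<Longrightarrow> UB \<in> verts H" "EB1 \<in> arcs H \<Longrightarrow> VB \<in> verts H"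
      "EB2 \<in> arcs H \<Longrightarrow> VB \<in> verts H" "EB2 \<in> arcs H \<Longrightarrow> V0B \<in> verts H"
      using subgraph_arc_ends[OF H, of FB1] subgraph_arc_ends[OF H, of FB3]
        subgraph_arc_ends[OF H, of EB1] subgraph_arc_ends[OF H, of EB2] by auto
    show arcsF: "arcs H \<subseteq> F" and "tail H = tail_B" "head H = head_B"
      using H by (auto simp: subgraph_def compatible_def)
    then have arcs: "arcs H \<subseteq> {FB1, FB3, EB1, EB2}" using F by blast
    have verts: "verts H - V0_B \<subseteq> {UB, VB}" "V0_B \<inter> verts H \<subseteq> {V0B}"
      using H by (auto simp: subgraph_def V0_B_def)
    show "arcs H \<noteq> {} \<longleftrightarrow> FB1 \<in> arcs H \<or> FB3 \<in> arcs H \<or> EB1 \<in> arcs H \<or> EB2 \<in> arcs H"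
      using arcs by blast
    show "card (arcs H) = of_bool (FB1 \<in> arcs H) + of_bool (FB3 \<in> arcs H)
      + of_bool (EB1 \<in> arcs H) + of_bool (EB2 \<in> arcs H)"
      using card_eq_sum_of_bool[OF _ arcs] by simp
    show "card (verts H - V0_B) = of_bool (UB \<in> verts H) + of_bool (VB \<in> verts H)"
      using card_eq_sum_of_bool[OF _ verts(1)] by (simp add: V0_B_def)
    show "card (V0_B \<inter> verts H) = of_bool (V0B \<in> verts H)"
      using card_eq_sum_of_bool[OF _ verts(2)] by (simp add: V0_B_def)
  qed
  have sparse: "sparse V0_B m 1 ?K"
    unfolding sparse_def
  proof (intro allI impI)
    fix H assume "subgraph H ?K \<and> arcs H \<noteq> {}"
    then have H: "subgraph H ?K" "arcs H \<noteq> {}" by auto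
    show "int (card (arcs H)) \<le> 2 * int (card (verts H - V0_B)) + m * int (card (V0_B \<inter> verts H)) - 1"
      unfolding card_arcs[OF H(1)] card_free[OF H(1)] card_fixed[OF H(1)]
      of_nat_add of_nat_of_bool
    proof (rule sparse_count_B)
      show "FB3 \<in> arcs H \<longrightarrow> m = 1" using F(2) arcsF[OF H(1)] by auto
      show "m = 0 \<or> m = 1" using F(3) by simp
      show "FB1 \<in> arcs H \<or> FB3 \<in> arcs H \<or> EB1 \<in> arcs H \<or> EB2 \<in> arcs H"
        using nonempty[OF H(1)] H(2) by simp
    qed (simp_all add: ends[OF H(1)])
  qed
  have "sparse V0_B 2 3 H" if H: "subgraph H ?K" "balanced \<Gamma> V0_B (psi_B \<Gamma> \<gamma>) H" for H
    unfolding sparse_def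
  proof (intro allI impI)
    fix H' assume H': "subgraph H' H \<and> arcs H' \<noteq> {}"
    \<comment> \<open>Both loop gains are nontrivial, so a balanced subgraph contains neither
      loop.\<close>
    have no_loops: "FB1 \<notin> arcs H" "FB3 \<notin> arcs H"
      using H(2) loop_unbalanced[of FB1 H UB V0_B "psi_B \<Gamma> \<gamma>"] loop_unbalanced[of FB3 H VB V0_B "psi_B \<Gamma> \<gamma>"]
        ends[OF H(1)] ts[OF H(1)] gen_neq_one by (auto simp: V0_B_def)
    moreover have "arcs H' \<subseteq> arcs H" using H' by (simp add: subgraph_def)
    ultimately have no: "FB1 \<notin> arcs H'" "FB3 \<notin> arcs H'" by auto
    have K': "subgraph H' ?K" using H' H(1) sub by blast
    show "int (card (arcs H')) \<le> 2 * int (card (verts H' - V0_B)) + 2 * int (card (V0_B \<inter> verts H')) - 3"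
      unfolding card_arcs[OF K'] card_free[OF K'] card_fixed[OF K']
      of_nat_add of_nat_of_bool
    proof (rule balanced_count_B)
      show "EB1 \<in> arcs H' \<or> EB2 \<in> arcs H'" using nonempty[OF K'] H' no by simp
    qed (simp_all add: no ends[OF K'])
  qed
  moreover have "int (card (arcs ?K)) = 2 * int (card (verts ?K - V0_B)) + m * int (card (V0_B \<inter> verts ?K)) - 1"
    using m by (elim disjE) (simp_all add: V0_B_def)
  ultimately show ?thesis
    using sparse unfolding gain_tight_def gain_sparse_def tight_def by blast
qed

text \<open>Without \<open>EB1\<close> the loops at \<open>UB\<close> and the edge
  \<open>EB2\<close> lie in different components. The first pays for its loops by
  \<open>bouquet_count\<close>, the second contributes at least \<open>2 * 2 - 3\<close>, enough for
  one edge.\<close>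

lemma f_count_B_disconnected:
  assumes F: "F \<subseteq> {FB1, FB2, EB2}" "EB2 \<in> F" "F \<inter> {FB1, FB2} \<noteq> {}"
    and j: "2 \<le> j" "j \<le> k - 2"
  shows "int (card F) \<le> f_count \<Gamma> V0_B (psi_B \<Gamma> \<gamma>) k j G_B F"
proof -
  let ?E = "edge_subgraph G_B F" and ?a = "alpha \<Gamma> V0_B (psi_B \<Gamma> \<gamma>) k j"
  have V: "verts ?E = {UB, VB, V0B}"
    using F(2,3) imageI[of FB1 F tail_B] imageI[of FB2 F tail_B] imageI[of EB2 F tail_B]
      imageI[of EB2 F head_B] vertexB_eq by auto
  have closed: "tail_B e = UB \<longleftrightarrow> head_B e = UB" if "e \<in> F" for e
    using that F(1) by (cases e) auto
  have U: "{u. \<exists>w. gwalk ?E v w u} = {UB}" if "v \<in> {UB}" for v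
    using V that closed by (intro star_reachable[where r = UB]) simp_all
  have W: "{u. \<exists>w. gwalk ?E v w u} = {VB, V0B}" if "v \<in> {VB, V0B}" for v
  proof (rule star_reachable[where r = VB, OF _ _ that])
    show "tail ?E e \<in> {VB, V0B} \<longleftrightarrow> head ?E e \<in> {VB, V0B}" if "e \<in> arcs ?E" for e
      using closed[of e] that vertexB_eq[of "tail_B e"] vertexB_eq[of "head_B e"] by auto
    show "\<exists>e\<in>arcs ?E. {tail ?E e, head ?E e} = {VB, u}" if "u \<in> {VB, V0B}" "u \<noteq> VB" for u
      using F(2) that by (intro bexI[of _ EB2]) auto
  qed (use V in auto)
  have comps: "components ?E = {?E \<restriction> {UB}, ?E \<restriction> {VB, V0B}}"
    unfolding components_image V image_insert image_empty using U[of UB] W[of VB] W[of V0B] by simp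
  \<comment> \<open>The sum runs over a set, so two terms require the components to be
    distinct.\<close>
  have "verts (?E \<restriction> {UB}) \<noteq> verts (?E \<restriction> {VB, V0B})"
    by auto
  then have "?E \<restriction> {UB} \<noteq> ?E \<restriction> {VB, V0B}" by metis
  then have count: "f_count \<Gamma> V0_B (psi_B \<Gamma> \<gamma>) k j G_B F = ?a (?E \<restriction> {UB}) - 1 + (1 + ?a (?E \<restriction> {VB, V0B}))"
    by (simp add: f_count_def comps)
  have "0 \<le> ?a (?E \<restriction> {VB, V0B})" by (intro alpha_nonneg) (simp add: V0_B_def)
  moreover have arcs: "arcs (?E \<restriction> {UB}) = F \<inter> {FB1, FB2}"
    using F by (auto simp: induce_subgraph_def)
  have "int (card (arcs (?E \<restriction> {UB}))) \<le> ?a (?E \<restriction> {UB}) - 1"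
  proof (rule bouquet_count[where x = UB and a = FB1 and b = FB2])
    show "arcs (?E \<restriction> {UB}) \<subseteq> {FB1, FB2}" "arcs (?E \<restriction> {UB}) \<noteq> {}"
      unfolding arcs using F(3) by auto
    show "tail (?E \<restriction> {UB}) e = UB \<and> head (?E \<restriction> {UB}) e = UB" if "e \<in> arcs (?E \<restriction> {UB})" for e
      using that by (auto simp: induce_subgraph_def)
  qed (use j in \<open>simp_all add: V0_B_def\<close>)
  moreover have "card F = card (insert EB2 (F \<inter> {FB1, FB2}))"
    using F by (intro arg_cong[of _ _ card]) auto
  then have "card F = card (F \<inter> {FB1, FB2}) + 1" by simp
  ultimately show ?thesis unfolding count arcs by simp
qed

lemma f_count_B:
  assumes F: "F \<subseteq> {FB1, FB2, EB1, EB2}" "F \<noteq> {}" and j: "2 \<le> j" "j \<le> k - 2"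
  shows "int (card F) \<le> f_count \<Gamma> V0_B (psi_B \<Gamma> \<gamma>) k j G_B F"
proof -
  let ?E = "edge_subgraph G_B F" and ?a = "alpha \<Gamma> V0_B (psi_B \<Gamma> \<gamma>) k j"
  have nonneg: "0 \<le> ?a ?E"
    by (rule alpha_nonneg) (simp add: V0_B_def Int_insert_left)
  consider "EB1 \<in> F" "EB2 \<in> F" | "EB1 \<in> F" "EB2 \<notin> F" | "EB1 \<notin> F" "EB2 \<in> F" | "EB1 \<notin> F" "EB2 \<notin> F"
    by blast
  then show ?thesis
  proof cases
    \<comment> \<open>The bound is \<open>3 + alpha\<close>. Three edges are covered by
      nonnegativity; all four need \<open>alpha\<close> = 1, which is \<open>3 - 2\<close> for the
      full gain group with the fixed vertex present.\<close>
    case 1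
    have V: "tail_B ` F \<union> head_B ` F = {UB, VB, V0B}"
      using imageI[OF 1(1), of tail_B] imageI[OF 1(2), of tail_B] imageI[OF 1(2), of head_B]
        vertexB_eq by auto
    have star: "\<exists>e\<in>F. {tail_B e, head_B e} = {VB, u}" if "u \<noteq> VB" for u
    proof (cases "u = UB")
      case True
      then show ?thesis using 1 by (intro bexI[of _ EB1]) auto
    next
      case False
      then show ?thesis using 1 that vertexB_eq[of u] by (intro bexI[of _ EB2]) auto
    qed
    have count: "f_count \<Gamma> V0_B (psi_B \<Gamma> \<gamma>) k j G_B F = 2 * int (card {UB, VB, V0B}) - 3 + ?a ?E"
      using star by (intro f_count_star[where r = VB]) (simp_all add: V)
    show ?thesis
    proof (cases "F = {FB1, FB2, EB1, EB2}")
      case True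
      have "\<gamma> \<in> carrier (gain_group \<Gamma> V0_B (psi_B \<Gamma> \<gamma>) ?E)"
        using loop_gain_in_gain_group[of FB1 ?E UB V0_B "psi_B \<Gamma> \<gamma>"] True by (simp add: V0_B_def)
      then have "?a ?E = 3 - 2 * int (card (V0_B \<inter> verts ?E))"
        using k_ge
        by (intro alpha_full_gain_group card_gain_group_full j) (auto simp: V0_B_def V)
      moreover have "V0_B \<inter> verts ?E = {V0B}" by (simp add: V V0_B_def)
      ultimately show ?thesis unfolding count using True by simp
    next
      case False
      then have "card F < card {FB1, FB2, EB1, EB2}" using F by (intro psubset_card_mono) auto
      then show ?thesis unfolding count using nonneg by simp
    qed
  next
    \<comment> \<open>The bound is \<open>1 + alpha\<close>, and any loop present raises
      \<open>alpha\<close> to at least 2.\<close>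
    case 2
    have V: "tail_B ` F \<union> head_B ` F = {UB, VB}"
    proof -
      have "tail_B e \<in> {UB, VB} \<and> head_B e \<in> {UB, VB}" if "e \<in> F" for e
        using that F(1) 2 by (cases e) auto
      then show ?thesis
        using imageI[OF 2(1), of tail_B] imageI[OF 2(1), of head_B] by auto
    qed
    have star: "\<exists>e\<in>F. {tail_B e, head_B e} = {UB, u}" if "u = VB" for u
      using 2 that by (intro bexI[of _ EB1]) auto
    have count: "f_count \<Gamma> V0_B (psi_B \<Gamma> \<gamma>) k j G_B F = 2 * int (card {UB, VB}) - 3 + ?a ?E"
      using star by (intro f_count_star[where r = UB]) (auto simp: V)
    show ?thesis
    proof (cases "F = {EB1}")
      case True
      then show ?thesis unfolding count using nonneg by simp
    next
      case False
      then obtain e where e: "e \<in> F" "e = FB1 \<or> e = FB2" using F 2 by blast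
      then have "3 \<le> card (carrier (gain_group \<Gamma> V0_B (psi_B \<Gamma> \<gamma>) ?E))"
        by (intro card_gain_group_loop[of e _ UB]) (auto simp: V V0_B_def)
      then have "2 \<le> ?a ?E" by (intro alpha_ge_2) (auto simp: V V0_B_def)
      moreover have "card F \<le> card {FB1, FB2, EB1}" using F 2 by (intro card_mono) auto
      ultimately show ?thesis unfolding count by simp
    qed
  next
    case 3
    show ?thesis
    proof (cases "F \<inter> {FB1, FB2} = {}")
      case True
      then have F1: "F = {EB2}" using F 3 by blast
      have "f_count \<Gamma> V0_B (psi_B \<Gamma> \<gamma>) k j G_B F = 2 * int (card {VB, V0B}) - 3 + ?a ?E"
        by (intro f_count_star[where r = VB]) (auto simp: F1)
      then show ?thesis using nonneg by (simp add: F1)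
    next
      case False
      then show ?thesis using F 3 j by (intro f_count_B_disconnected) auto
    qed
  next
    case 4
    then have F2: "F \<subseteq> {FB1, FB2}" using F by auto
    have "tail_B ` F = (\<lambda>_. UB) ` F" "head_B ` F = (\<lambda>_. UB) ` F"
      using F2 by (auto intro!: image_cong)
    then have V: "tail_B ` F \<union> head_B ` F = {UB}" using F(2) by (simp add: image_constant_conv)
    have "f_count \<Gamma> V0_B (psi_B \<Gamma> \<gamma>) k j G_B F = 2 * int (card {UB}) - 3 + ?a ?E"
      by (intro f_count_star[where r = UB]) (auto simp: V)
    moreover have "int (card (arcs ?E)) \<le> ?a ?E - 1"
      using F2 F(2) V j by (intro bouquet_count[where x = UB and a = FB1 and b = FB2]) (auto simp: V0_B_def)
    ultimately show ?thesis by simp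
  qed
qed

lemma Zkj_tight_B:
  assumes j: "2 \<le> j" "j \<le> k - 2"
  shows "Zkj_tight \<Gamma> V0_B (psi_B \<Gamma> \<gamma>) k j (G_B\<lparr>arcs := {FB1, FB2, EB1, EB2}\<rparr>)"
  unfolding Zkj_tight_def Zkj_sparse_def
proof (intro conjI allI impI)
  let ?K = "G_B\<lparr>arcs := {FB1, FB2, EB1, EB2}\<rparr>"
  fix H assume "subgraph H ?K \<and> arcs H \<noteq> {}"
  then have "arcs H \<subseteq> {FB1, FB2, EB1, EB2}" "arcs H \<noteq> {}" by (auto simp: subgraph_def)
  then have "int (card (arcs H)) \<le> f_count \<Gamma> V0_B (psi_B \<Gamma> \<gamma>) k j G_B (arcs H)"
    using j by (rule f_count_B)
  also have "\<dots> = f_count \<Gamma> V0_B (psi_B \<Gamma> \<gamma>) k j ?K (arcs H)"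
    by (rule f_count_cong) simp_all
  finally show "int (card (arcs H)) \<le> f_count \<Gamma> V0_B (psi_B \<Gamma> \<gamma>) k j ?K (arcs H)" .
qed (simp add: V0_B_def)

section \<open>Non-trivial motions of the two liftings\<close>

lemma motion_A:
  assumes sym: "Ck_symmetric \<Gamma> \<gamma> (lift_act \<Gamma>) (lifting \<Gamma> V0_A (psi_A \<Gamma> \<gamma>) G_A) p"
  obtains m where "inf_motion (lifting \<Gamma> V0_A (psi_A \<Gamma> \<gamma>) G_A) p m"
    "\<not> trivial_motion (lifting \<Gamma> V0_A (psi_A \<Gamma> \<gamma>) G_A) p m"
    "rho_symmetric \<Gamma> \<gamma> (lift_act \<Gamma>) (lifting \<Gamma> V0_A (psi_A \<Gamma> \<gamma>) G_A) (k div 2) m"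
proof
  let ?\<xi> = "\<lambda>v. 1 *\<^sub>R p (Free v \<one>)"
  have p: "p (Free VA g) = tau \<Gamma> \<gamma> g *v p (Free VA \<one>)" if "g \<in> carrier \<Gamma>" for g
    using Ck_symmetric_Free[OF sym, of VA g] that by (simp add: V0_A_def)
  show "inf_motion (lifting \<Gamma> V0_A (psi_A \<Gamma> \<gamma>) G_A) p (half_motion ?\<xi>)"
  proof (rule half_motion_inf_motion[OF sym gain_graph_A])
    fix e
    \<comment> \<open>Both gains are odd powers, so the same orthogonality covers both
      loops.\<close>
    obtain t :: nat where t: "psi_A \<Gamma> \<gamma> e = \<gamma> [^] t" "odd t"
    proof (cases e)
      case FA1
      then show thesis using that[of 1] by simp
    next
      case FA2
      then show thesis using that[of 3] by simp
    qed
    show "(p (lvert V0_A (tail G_A e) \<one>) - p (lvert V0_A (head G_A e) (psi_A \<Gamma> \<gamma> e))) \<bullet>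
      (half_motion ?\<xi> (lvert V0_A (tail G_A e) \<one>) -
       half_motion ?\<xi> (lvert V0_A (head G_A e) (psi_A \<Gamma> \<gamma> e))) = 0"
      using p[of "\<gamma> [^] t"] rotation_loop_odd[where s = 1] t
      by (simp add: lvert_def V0_A_def half_motion_def sign_pow tau_pow)
  qed
  show "\<not> trivial_motion (lifting \<Gamma> V0_A (psi_A \<Gamma> \<gamma>) G_A) p (half_motion ?\<xi>)"
    by (rule radial_motion_nontrivial[OF sym, where v = VA and s = 1]) (auto simp: V0_A_def)
qed (rule half_motion_rho_symmetric)

lemma motion_B:
  assumes sym: "Ck_symmetric \<Gamma> \<gamma> (lift_act \<Gamma>) (lifting \<Gamma> V0_B (psi_B \<Gamma> \<gamma>) G_B) p"
  obtains m where "inf_motion (lifting \<Gamma> V0_B (psi_B \<Gamma> \<gamma>) G_B) p m"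
    "\<not> trivial_motion (lifting \<Gamma> V0_B (psi_B \<Gamma> \<gamma>) G_B) p m"
    "rho_symmetric \<Gamma> \<gamma> (lift_act \<Gamma>) (lifting \<Gamma> V0_B (psi_B \<Gamma> \<gamma>) G_B) (k div 2) m"
proof
  let ?L = "lifting \<Gamma> V0_B (psi_B \<Gamma> \<gamma>) G_B"
  define a b where "a = p (Free UB \<one>)" and "b = p (Free VB \<one>)"
  \<comment> \<open>The edge from \<open>UB\<close> to \<open>VB\<close> asks that \<open>s\<close>
    times \<open>a \<bullet> (a - b)\<close> equal \<open>r\<close> times
    \<open>(a - b) \<bullet> perp b\<close>. As \<open>b\<close> is orthogonal to
    \<open>perp b\<close>, the last product is \<open>a \<bullet> perp b\<close>, and this choice
    gives \<open>s * r\<close> on both sides.\<close>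
  define s r where "s = a \<bullet> perp b" and "r = a \<bullet> (a - b)"
  define \<xi> where "\<xi> v = (if v = UB then s *\<^sub>R a else r *\<^sub>R perp b)" for v
  have pU: "p (Free UB g) = tau \<Gamma> \<gamma> g *v a" and pV: "p (Free VB g) = tau \<Gamma> \<gamma> g *v b"
    if "g \<in> carrier \<Gamma>" for g
    using Ck_symmetric_Free[OF sym, of UB g] Ck_symmetric_Free[OF sym, of VB g] that
    by (simp_all add: V0_B_def a_def b_def)
  have p0: "p (Fixed V0B) = 0"
    using Ck_symmetric_Fixed[OF sym, of V0B] by (simp add: V0_B_def)
  show "inf_motion ?L p (half_motion \<xi>)"
  proof (rule half_motion_inf_motion[OF sym gain_graph_B])
    fix e assume "e \<in> arcs G_B"
    have u_loop: "(a - tau \<Gamma> \<gamma> (\<gamma> [^] t) *v a) \<bullet> (\<xi> UB - sign (\<gamma> [^] t) *\<^sub>R (tau \<Gamma> \<gamma> (\<gamma> [^] t) *v \<xi> UB)) = 0"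
      if "odd t" for t :: nat
      using that rotation_loop_odd by (simp add: sign_pow tau_pow \<xi>_def)
    have v_loop: "(b - tau \<Gamma> \<gamma> (\<gamma> [^] t) *v b) \<bullet> (\<xi> VB - sign (\<gamma> [^] t) *\<^sub>R (tau \<Gamma> \<gamma> (\<gamma> [^] t) *v \<xi> VB)) = 0"
      if "even t" for t :: nat
      using that rotation_loop_even by (simp add: sign_pow tau_pow \<xi>_def)
    have uv: "(a - b) \<bullet> (\<xi> UB - \<xi> VB) = 0"
      by (simp add: \<xi>_def s_def r_def inner_vec2 perp_nth algebra_simps)
    have v0: "b \<bullet> \<xi> VB = 0"
      by (simp add: \<xi>_def inner_vec2 perp_nth)
    show "(p (lvert V0_B (tail G_B e) \<one>) - p (lvert V0_B (head G_B e) (psi_B \<Gamma> \<gamma> e))) \<bullet>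
      (half_motion \<xi> (lvert V0_B (tail G_B e) \<one>) -
       half_motion \<xi> (lvert V0_B (head G_B e) (psi_B \<Gamma> \<gamma> e))) = 0"
      using u_loop[of 1] u_loop[of 3] v_loop[of 2] uv v0
      by (cases e) (simp_all add: lvert_def V0_B_def half_motion_def pU pV p0)
  qed
  have mem: "Free UB \<one> \<in> sverts ?L" "Free VB \<one> \<in> sverts ?L" "Free UB \<gamma> \<in> sverts ?L"
    by (auto intro!: Free_in_lifting simp: V0_B_def)
  have inj: "inj_on p (sverts ?L)"
    using sym by (simp add: Ck_symmetric_def framework_def)
  have "a \<noteq> b" unfolding a_def b_def using inj mem by (auto dest: inj_onD)
  have "a \<noteq> 0"
  proof
    assume "a = 0"
    then have "p (Free UB \<one>) = p (Free UB \<gamma>)" using pU[of \<gamma>] by (simp add: a_def)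
    then show False using inj mem gen_neq_one by (auto dest: inj_onD)
  qed
  show "\<not> trivial_motion ?L p (half_motion \<xi>)"
  \<comment> \<open>The two coefficients cannot both vanish; whichever is nonzero selects the test,
    radial at \<open>UB\<close> or perpendicular at \<open>VB\<close>.\<close>
  proof (cases "s = 0")
    case False
    then show ?thesis
      by (intro radial_motion_nontrivial[OF sym, where v = UB and s = s]) (auto simp: V0_B_def \<xi>_def a_def)
  next
    case True
    have "r \<noteq> 0"
    proof
      assume "r = 0"
      \<comment> \<open>if \<open>s = r = 0\<close>, then \<open>a - b\<close> is orthogonal to \<open>a\<close> and to \<open>perp a\<close>\<close>
      have eq: "a $ 1 * (a - b) $ 1 + a $ 2 * (a - b) $ 2 = 0" "a $ 1 * (a - b) $ 2 - a $ 2 * (a - b) $ 1 = 0"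
        using True \<open>r = 0\<close> by (simp_all add: s_def r_def inner_vec2 perp_nth algebra_simps)
      \<comment> \<open>Lagrange's identity: the product of the squared lengths is the sum of the
        squares of the two expressions in \<open>eq\<close>.\<close>
      have "((a - b) $ 1 * (a - b) $ 1 + (a - b) $ 2 * (a - b) $ 2) * (a $ 1 * a $ 1 + a $ 2 * a $ 2) = 0"
        using eq by Groebner_Basis.algebra
      then have "a = 0 \<or> a - b = 0"
        by (auto simp: vec2_eq_iff sum_squares_eq_zero_iff)
      then show False using \<open>a \<noteq> 0\<close> \<open>a \<noteq> b\<close> by simp
    qed
    then show ?thesis
      by (intro perp_motion_nontrivial[OF sym, where v = VB and r = r]) (auto simp: V0_B_def \<xi>_def b_def)
  qed
qed (rule half_motion_rho_symmetric)

end

theorem mainTheorem3: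
  fixes \<Gamma> :: "('g, 'b) monoid_scheme" and \<gamma> :: 'g and k :: nat
  assumes "8 \<le> k" and "even k"
    and "group \<Gamma>" and "\<gamma> \<in> carrier \<Gamma>" and "carrier \<Gamma> = generate \<Gamma> {\<gamma>}" and "order \<Gamma> = k"
  defines "\<psi>A \<equiv> psi_A \<Gamma> \<gamma>" and "\<psi>B \<equiv> psi_B \<Gamma> \<gamma>"
  defines "LA \<equiv> lifting \<Gamma> V0_A \<psi>A G_A" and "LB \<equiv> lifting \<Gamma> V0_B \<psi>B G_B"
  shows "(gain_graph \<Gamma> V0_A \<psi>A G_A \<and> gain_graph \<Gamma> V0_B \<psi>B G_B) \<and>
    ((\<exists>H. spanning H G_A \<and> gain_tight \<Gamma> V0_A \<psi>A 0 1 H) \<and>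
     (\<exists>H. spanning H G_A \<and> gain_tight \<Gamma> V0_A \<psi>A 1 1 H) \<and>
     (\<forall>j. 2 \<le> j \<and> j \<le> k - 2 \<longrightarrow> (\<exists>H. spanning H G_A \<and> Zkj_tight \<Gamma> V0_A \<psi>A k j H))) \<and>
    ((\<exists>H. spanning H G_B \<and> gain_tight \<Gamma> V0_B \<psi>B 0 1 H) \<and>
     (\<exists>H. spanning H G_B \<and> gain_tight \<Gamma> V0_B \<psi>B 1 1 H) \<and>
     (\<forall>j. 2 \<le> j \<and> j \<le> k - 2 \<longrightarrow> (\<exists>H. spanning H G_B \<and> Zkj_tight \<Gamma> V0_B \<psi>B k j H))) \<and>
    (\<forall>p. Ck_symmetric \<Gamma> \<gamma> (lift_act \<Gamma>) LA p \<longrightarrow> \<not> inf_rigid LA p) \<and>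
    (\<forall>p. Ck_symmetric \<Gamma> \<gamma> (lift_act \<Gamma>) LB p \<longrightarrow> \<not> inf_rigid LB p) \<and>
    (\<forall>p. Ck_symmetric \<Gamma> \<gamma> (lift_act \<Gamma>) LA p \<longrightarrow>
       (\<exists>m. inf_motion LA p m \<and> \<not> trivial_motion LA p m \<and>
            rho_symmetric \<Gamma> \<gamma> (lift_act \<Gamma>) LA (k div 2) m)) \<and>
    (\<forall>p. Ck_generic \<Gamma> \<gamma> (lift_act \<Gamma>) LB p \<longrightarrow>
       (\<exists>m. inf_motion LB p m \<and> \<not> trivial_motion LB p m \<and>
            rho_symmetric \<Gamma> \<gamma> (lift_act \<Gamma>) LB (k div 2) m))"
proof -
  interpret cyclic_rotation_group \<Gamma> \<gamma> k
    using assms(1-6) by (intro cyclic_rotation_group.intro cyclic_rotation_group_axioms.intro)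
  have A: "\<exists>m. inf_motion LA p m \<and> \<not> trivial_motion LA p m \<and> rho_symmetric \<Gamma> \<gamma> (lift_act \<Gamma>) LA (k div 2) m"
    if "Ck_symmetric \<Gamma> \<gamma> (lift_act \<Gamma>) LA p" for p
    using motion_A that unfolding LA_def \<psi>A_def by metis
  have B: "\<exists>m. inf_motion LB p m \<and> \<not> trivial_motion LB p m \<and> rho_symmetric \<Gamma> \<gamma> (lift_act \<Gamma>) LB (k div 2) m"
    if "Ck_symmetric \<Gamma> \<gamma> (lift_act \<Gamma>) LB p" for p
    using motion_B that unfolding LB_def \<psi>B_def by metis
  have "spanning G_A G_A"
    using gain_graph_A by (auto simp: spanning_def subgraph_def compatible_def gain_graph_def fin_digraph_def)
  then have combA: "(\<exists>H. spanning H G_A \<and> gain_tight \<Gamma> V0_A \<psi>A 0 1 H) \<and>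
     (\<exists>H. spanning H G_A \<and> gain_tight \<Gamma> V0_A \<psi>A 1 1 H) \<and>
     (\<forall>j. 2 \<le> j \<and> j \<le> k - 2 \<longrightarrow> (\<exists>H. spanning H G_A \<and> Zkj_tight \<Gamma> V0_A \<psi>A k j H))"
    unfolding \<psi>A_def using spanning_loop_A gain_tight_A Zkj_tight_A by blast
  have span: "spanning (G_B\<lparr>arcs := {FB1, EB1, EB2}\<rparr>) G_B"
    "spanning (G_B\<lparr>arcs := {FB1, FB3, EB1, EB2}\<rparr>) G_B"
    "spanning (G_B\<lparr>arcs := {FB1, FB2, EB1, EB2}\<rparr>) G_B"
    by (auto intro!: spanning_B)
  have combB: "(\<exists>H. spanning H G_B \<and> gain_tight \<Gamma> V0_B \<psi>B 0 1 H) \<and>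
     (\<exists>H. spanning H G_B \<and> gain_tight \<Gamma> V0_B \<psi>B 1 1 H) \<and>
     (\<forall>j. 2 \<le> j \<and> j \<le> k - 2 \<longrightarrow> (\<exists>H. spanning H G_B \<and> Zkj_tight \<Gamma> V0_B \<psi>B k j H))"
    unfolding \<psi>B_def using span gain_tight_B[of 0] gain_tight_B[of 1] Zkj_tight_B by blast
  have "\<not> inf_rigid LA p" if "Ck_symmetric \<Gamma> \<gamma> (lift_act \<Gamma>) LA p" for p
    using A[OF that] by (auto simp: inf_rigid_def)
  moreover have "\<not> inf_rigid LB p" if "Ck_symmetric \<Gamma> \<gamma> (lift_act \<Gamma>) LB p" for p
    using B[OF that] by (auto simp: inf_rigid_def)
  moreover have "Ck_symmetric \<Gamma> \<gamma> (lift_act \<Gamma>) LB p" if "Ck_generic \<Gamma> \<gamma> (lift_act \<Gamma>) LB p" for p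
    using that by (simp add: Ck_generic_def)
  ultimately show ?thesis
    using gain_graph_A gain_graph_B combA combB A B unfolding \<psi>A_def \<psi>B_def by blast
qed

end
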